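(* Let $D$ be a direct tract of $f$, let $M_D(r)=\max_{|z|=r,\,z\in D}|f(z)|$, and let $\rho_0>R$ be such that $M_D(\rho)>\rho$ for all $\rho>\rho_0$. Then for every $\rho>\rho_0$ the set $$A(f,D,\rho)=\{z\in D: f^n(z)\in D\text{ and }|f^n(z)|\ge M_D^n(\rho)\text{ for all }n\in\mathbb{N}\}$$ is nonempty.
   Context: A direct tract of $f$: $D$ is an unbounded domain with piecewise smooth boundary curves and unbounded complement; $f$ is defined on $\overline{D}$, holomorphic in $D$, continuous on $\overline{D}$, and there is $R>0$ with $|f|=R$ on $\partial D$ and $|f|>R$ in $D$. $M_D^n$ denotes the $n$-th iterate of the real function $M_D$. (Such $\rho_0$ exists since $\log M_D(r)/\log r\to\infty$.) *)

theory Defs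
  imports "HOL-Complex_Analysis.Complex_Analysis"
begin

definition piecewise_smooth_boundary :: "complex set \<Rightarrow> bool" where
  "piecewise_smooth_boundary D \<longleftrightarrow>
     (\<exists>\<Gamma> :: (real \<Rightarrow> complex) set.
        (\<forall>g\<in>\<Gamma>. valid_path g) \<and>
        frontier D = (\<Union>g\<in>\<Gamma>. path_image g) \<and>
        (\<forall>B. bounded B \<longrightarrow> finite {g\<in>\<Gamma>. path_image g \<inter> B \<noteq> {}}))"

definition direct_tract :: "(complex \<Rightarrow> complex) \<Rightarrow> complex set \<Rightarrow> real \<Rightarrow> bool" where
  "direct_tract f D R \<longleftrightarrow>
     open D \<and> connected D \<and> \<not> bounded D \<and> \<not> bounded (- D) \<and>
     piecewise_smooth_boundary D \<and>
     f holomorphic_on D \<and> continuous_on (closure D) f \<and>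
     R > 0 \<and> (\<forall>z\<in>frontier D. norm (f z) = R) \<and> (\<forall>z\<in>D. norm (f z) > R)"

definition MD :: "(complex \<Rightarrow> complex) \<Rightarrow> complex set \<Rightarrow> real \<Rightarrow> real" where
  "MD f D r = Sup ((\<lambda>z. norm (f z)) ` (D \<inter> sphere 0 r))"

definition A_set :: "(complex \<Rightarrow> complex) \<Rightarrow> complex set \<Rightarrow> real \<Rightarrow> complex set" where
  "A_set f D \<rho> = {z\<in>D. \<forall>n::nat. (f ^^ n) z \<in> D \<and> norm ((f ^^ n) z) \<ge> (MD f D ^^ n) \<rho>}"

end

theory Submission
  imports Defs
begin

text \<open>
  Write \<open>M\<close> for the maximum modulus \<open>MD f D\<close>. If \<open>X\<close> is an unbounded domain in \<open>{|w| > R}\<close>, every component of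
  the preimage of \<open>X\<close> in \<open>D\<close> is again unbounded, since \<open>f\<close> would map a bounded one properly onto \<open>X\<close>.
  Pulling back \<open>{|w| > M\<^sup>N(\<rho>)}\<close> thus gives unbounded domains on which the first \<open>N\<close> iterates have the
  required size, and compactness yields a point of \<open>A(f,D,\<rho>)\<close> provided that these domains all meet one
  fixed disc. This follows from a covering property: for large \<open>r\<close>, the image of \<open>D \<inter> {|z| < 1600 r}\<close>
  meets every unbounded connected set that avoids \<open>{|w| < M(r)}\<close> and meets \<open>{|w| \<le> 1600 M(r)}\<close>.

  The covering property is proved by composing \<open>f\<close> with the inverse of a Koebe function and
  comparing growth on three circles. It needs \<open>M(r)/r\<^sup>2 \<rightarrow> \<infinity>\<close>, which comes from the circular means of a
  convex function of \<open>ln |f|\<close>: their logarithmic derivative, the flux, is increasing in the radius,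
  with a definite rate at circles that leave the tract, and it is a multiple of \<open>2\<pi>\<close> at circles well inside
  the tract. As the complement of \<open>D\<close> is unbounded, the flux cannot stay bounded.
\<close>

section \<open>A convex cutoff\<close>

text \<open>A smoothing of \<open>max 0 u\<close> with continuous second derivative:
  \<open>cutoff''\<close> is the hat function on [0,2] with peak 1 at 1, and the cubics integrate it
  twice. So \<open>cutoff\<close> is 0 for u \<le> 0 and u - 1 for u \<ge> 2.\<close>

definition cutoff :: "real \<Rightarrow> real" where
  "cutoff u = ((max 0 u)^3 - 2 * (max 0 (u - 1))^3 + (max 0 (u - 2))^3) / 6"

definition cutoff' :: "real \<Rightarrow> real" where
  "cutoff' u = ((max 0 u)^2 - 2 * (max 0 (u - 1))^2 + (max 0 (u - 2))^2) / 2"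

definition cutoff'' :: "real \<Rightarrow> real" where
  "cutoff'' u = max 0 u - 2 * max 0 (u - 1) + max 0 (u - 2)"

lemma has_real_derivative_max0_power:
  fixes c :: real
  assumes "n \<ge> 1"
  shows "((\<lambda>u. (max 0 (u - c)) ^ Suc n) has_real_derivative real (Suc n) * (max 0 (u - c)) ^ n) (at u)"
proof -
  have "((\<lambda>u. if u \<in> {c..} then (u - c) ^ Suc n else 0) has_vector_derivative
      (if u \<in> {c..} then real (Suc n) * (u - c) ^ n else 0)) (at u within UNIV)"
  proof (rule has_vector_derivative_If_within_closures[where T = "{..c}"])
    show "((\<lambda>u. (u - c) ^ Suc n) has_vector_derivative real (Suc n) * (u - c) ^ n)
         (at u within {c..} \<union> closure {c..} \<inter> closure {..c})"
      unfolding has_real_derivative_iff_has_vector_derivative[symmetric]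
      by (auto intro!: derivative_eq_intros simp del: power_Suc)
  qed (use assms in auto)
  moreover have "(\<lambda>u. if u \<in> {c..} then (u - c) ^ Suc n else 0) = (\<lambda>u. (max 0 (u - c)) ^ Suc n)"
    by (auto simp: fun_eq_iff max_def)
  moreover have "(if u \<in> {c..} then real (Suc n) * (u - c) ^ n else 0) = real (Suc n) * (max 0 (u - c)) ^ n"
    using assms by (auto simp: max_def)
  ultimately show ?thesis by (simp add: has_real_derivative_iff_has_vector_derivative)
qed

lemma cutoff_has_derivative: "(cutoff has_real_derivative cutoff' u) (at u)"
proof -
  have "((\<lambda>u. ((max 0 (u - 0))^Suc 2 - 2 * (max 0 (u - 1))^Suc 2 + (max 0 (u - 2))^Suc 2) / 6)
    has_real_derivative ((real (Suc 2) * (max 0 (u - 0))^2 - 2 * (real (Suc 2) * (max 0 (u - 1))^2)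
       + real (Suc 2) * (max 0 (u - 2))^2) / 6)) (at u)"
    by (intro DERIV_cdivide DERIV_add DERIV_diff DERIV_cmult has_real_derivative_max0_power) auto
  moreover have "cutoff = (\<lambda>u. ((max 0 (u - 0))^Suc 2 - 2 * (max 0 (u - 1))^Suc 2 + (max 0 (u - 2))^Suc 2) / 6)"
    by (auto simp: cutoff_def fun_eq_iff eval_nat_numeral)
  ultimately show ?thesis by (simp add: cutoff'_def diff_divide_distrib add_divide_distrib)
qed

lemma cutoff'_has_derivative: "(cutoff' has_real_derivative cutoff'' u) (at u)"
proof -
  have "((\<lambda>u. ((max 0 (u - 0))^Suc 1 - 2 * (max 0 (u - 1))^Suc 1 + (max 0 (u - 2))^Suc 1) / 2)
    has_real_derivative ((real (Suc 1) * (max 0 (u - 0))^1 - 2 * (real (Suc 1) * (max 0 (u - 1))^1)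
       + real (Suc 1) * (max 0 (u - 2))^1) / 2)) (at u)"
    by (intro DERIV_cdivide DERIV_add DERIV_diff DERIV_cmult has_real_derivative_max0_power) auto
  moreover have "cutoff' = (\<lambda>u. ((max 0 (u - 0))^Suc 1 - 2 * (max 0 (u - 1))^Suc 1 + (max 0 (u - 2))^Suc 1) / 2)"
    by (auto simp: cutoff'_def fun_eq_iff eval_nat_numeral)
  ultimately show ?thesis by (simp add: cutoff''_def diff_divide_distrib add_divide_distrib)
qed

lemma continuous_on_cutoff:
  "continuous_on A cutoff" "continuous_on A cutoff'" "continuous_on A cutoff''"
  unfolding cutoff_def cutoff'_def cutoff''_def by (intro continuous_intros; simp)+

lemma cutoff_nonpos [simp]:
  assumes "u \<le> 0" shows "cutoff u = 0" "cutoff' u = 0" "cutoff'' u = 0"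
  using assms by (simp_all add: cutoff_def cutoff'_def cutoff''_def max_def)

lemma cutoff'_eq_1: "u \<ge> 2 \<Longrightarrow> cutoff' u = 1"
  by (simp add: cutoff'_def max_def power2_eq_square algebra_simps)

lemma cutoff''_bounds: "0 \<le> cutoff'' u" "cutoff'' u \<le> 1"
  by (simp_all add: cutoff''_def max_def)

lemma cutoff'_le_1: "cutoff' u \<le> 1"
proof -
  have "cutoff' u \<le> cutoff' (max u 2)"
    by (rule DERIV_nonneg_imp_nondecreasing)
       (use cutoff'_has_derivative cutoff''_bounds in auto)
  then show ?thesis by (simp add: cutoff'_eq_1)
qed

lemma cutoff_le_max: "cutoff u \<le> max 0 u"
proof (cases "u \<le> 0")
  case False
  have "u - cutoff u \<ge> 0 - cutoff 0"
    by (rule DERIV_nonneg_imp_nondecreasing[of 0 u "\<lambda>u. u - cutoff u"])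
       (use False cutoff'_le_1 in \<open>auto intro!: derivative_eq_intros cutoff_has_derivative exI\<close>)
  then show ?thesis using False by simp
qed simp

section \<open>Logarithms of moduli and integrals over circles\<close>

lemma has_real_derivative_ln_norm:
  fixes \<gamma> :: "real \<Rightarrow> complex"
  assumes "(\<gamma> has_vector_derivative d) (at t)" "\<gamma> t \<noteq> 0"
  shows "((\<lambda>t. ln (norm (\<gamma> t))) has_real_derivative Re (d / \<gamma> t)) (at t)"
proof -
  have re: "((\<lambda>t. Re (\<gamma> t)) has_real_derivative Re d) (at t)"
    and im: "((\<lambda>t. Im (\<gamma> t)) has_real_derivative Im d) (at t)"
    using assms(1) by (auto simp: has_real_derivative_iff_has_vector_derivative
        intro: bounded_linear.has_vector_derivative[OF bounded_linear_Re]
          bounded_linear.has_vector_derivative[OF bounded_linear_Im])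
  have pos: "(Re (\<gamma> t))\<^sup>2 + (Im (\<gamma> t))\<^sup>2 > 0"
    using assms(2) by (simp add: complex_neq_0)
  have "((\<lambda>t. ln ((Re (\<gamma> t))\<^sup>2 + (Im (\<gamma> t))\<^sup>2) / 2) has_real_derivative
      ((2 * Re (\<gamma> t) * Re d + 2 * Im (\<gamma> t) * Im d) / ((Re (\<gamma> t))\<^sup>2 + (Im (\<gamma> t))\<^sup>2)) / 2) (at t)"
    by (rule derivative_eq_intros re im refl | use pos in \<open>simp add: field_simps; fail\<close>)+
  moreover have "(\<lambda>t. ln ((Re (\<gamma> t))\<^sup>2 + (Im (\<gamma> t))\<^sup>2) / 2) = (\<lambda>t. ln (norm (\<gamma> t)))"
    by (simp add: fun_eq_iff cmod_def ln_sqrt)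
  moreover have "((2 * Re (\<gamma> t) * Re d + 2 * Im (\<gamma> t) * Im d) / ((Re (\<gamma> t))\<^sup>2 + (Im (\<gamma> t))\<^sup>2)) / 2
      = Re (d / \<gamma> t)"
  proof -
    have "(2 * a * b + 2 * c * e) / n / 2 = (b * a + e * c) / n" for a b c e n :: real
      by (cases "n = 0") (auto simp: field_simps)
    then show ?thesis by (simp only: Re_divide)
  qed
  ultimately show ?thesis by simp
qed

text \<open>Differentiation under the integral sign. In the coordinate \<zeta> with z = exp \<zeta>,
  a circle about the origin is a vertical segment of length 2 pi, and x is the logarithm of its
  radius.\<close>

lemma circle_integral_has_derivative:
  fixes h h' :: "complex \<Rightarrow> real"
  assumes "continuous_on UNIV h" "continuous_on UNIV h'"
    and "\<And>c t. ((\<lambda>t. h (c + of_real t)) has_real_derivative h' (c + of_real t)) (at t)"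
  shows "((\<lambda>x. integral {0..2*pi} (\<lambda>\<theta>. h (of_real x + of_real \<theta> * \<i>))) has_real_derivative
    integral {0..2*pi} (\<lambda>\<theta>. h' (of_real x + of_real \<theta> * \<i>))) (at x)"
proof -
  have "((\<lambda>x. integral (cbox 0 (2*pi)) (\<lambda>\<theta>. h (of_real x + of_real \<theta> * \<i>))) has_field_derivative
    integral (cbox 0 (2*pi)) (\<lambda>\<theta>. h' (of_real x + of_real \<theta> * \<i>))) (at x within UNIV)"
  proof (rule leibniz_rule_field_derivative)
    fix x \<theta> :: real
    show "((\<lambda>x. h (of_real x + of_real \<theta> * \<i>)) has_field_derivative h' (of_real x + of_real \<theta> * \<i>))
      (at x within UNIV)"
      using assms(3)[of "of_real \<theta> * \<i>" x] by (simp add: add.commute)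
  next
    fix x :: real
    show "(\<lambda>\<theta>. h (of_real x + of_real \<theta> * \<i>)) integrable_on cbox 0 (2*pi)"
      by (intro integrable_continuous continuous_on_compose2[OF assms(1)] continuous_intros) auto
  next
    show "continuous_on (UNIV \<times> cbox 0 (2*pi)) (\<lambda>(x, \<theta>). h' (of_real x + of_real \<theta> * \<i>))"
      unfolding split_beta
      by (intro continuous_on_compose2[OF assms(2)] continuous_intros) auto
  qed auto
  then show ?thesis by simp
qed

lemma variation_le_integral:
  fixes p q b :: "real \<Rightarrow> real"
  assumes "\<And>t. (p has_real_derivative q t) (at t)" "\<And>t. \<bar>q t\<bar> \<le> b t"
    and "continuous_on UNIV q" "continuous_on UNIV b" "s \<in> {u..v}" "t \<in> {u..v}"
  shows "\<bar>p t - p s\<bar> \<le> integral {u..v} b"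
proof -
  have *: "\<bar>p t - p s\<bar> \<le> integral {u..v} b" if "s \<le> t" "{s..t} \<subseteq> {u..v}" for s t
  proof -
    have "(q has_integral p t - p s) {s..t}"
      using assms(1) that(1)
      by (intro fundamental_theorem_of_calculus)
        (auto simp: has_real_derivative_iff_has_vector_derivative[symmetric] intro: has_field_derivative_at_within)
    then have "\<bar>p t - p s\<bar> = norm (integral {s..t} q)"
      by (simp add: integral_unique)
    also have "\<dots> \<le> integral {s..t} b"
      using assms(2) continuous_on_subset[OF assms(3)] continuous_on_subset[OF assms(4)]
      by (intro integral_norm_bound_integral integrable_continuous_interval) auto
    also have "\<dots> \<le> integral {u..v} b"
      using that continuous_on_subset[OF assms(4)] order_trans[OF abs_ge_zero assms(2)]
      by (intro integral_subset_le integrable_continuous_interval) auto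
    finally show ?thesis .
  qed
  show ?thesis
    using *[of s t] *[of t s] assms(5,6) by (cases "s \<le> t") (auto simp: abs_minus_commute)
qed

lemma exp_circle_point:
  assumes "z \<noteq> 0"
  obtains \<theta> where "\<theta> \<in> {0..2*pi}" "z = exp (of_real (ln (norm z)) + of_real \<theta> * \<i>)"
proof
  show "Arg2pi z \<in> {0..2*pi}"
    using Arg2pi[of z] by auto
  show "z = exp (of_real (ln (norm z)) + of_real (Arg2pi z) * \<i>)"
    using Arg2pi_eq[of z] assms by (simp add: exp_add exp_of_real mult.commute)
qed

section \<open>An inverse Koebe function\<close>

text \<open>With \<open>g\<close> a branch of the square root of \<open>1 - w/p\<close> on \<open>G\<close>, the function \<open>K = (g - 1)/(g + 1)\<close>
  satisfies \<open>w/p = -4K/(1 - K)\<^sup>2\<close>: it inverts a rotated Koebe function and so replaces the Riemann map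
  of \<open>G\<close>.\<close>

lemma koebe_inverse_exists:
  fixes X :: "complex set"
  assumes X: "closed X" "connected X" "\<not> bounded X"
    and p: "p \<in> X" "\<And>w. w \<in> X \<Longrightarrow> norm p \<le> norm w" "p \<noteq> 0"
    and G: "G \<in> components (- X)"
  obtains K where "K holomorphic_on G"
    "\<And>w. w \<in> G \<Longrightarrow> norm (K w) \<le> 6"
    "\<And>w. w \<in> G \<Longrightarrow> norm (K w) \<le> 7 * norm w / norm p"
    "\<And>w. w \<in> G \<Longrightarrow> norm p \<le> norm w \<Longrightarrow> 1 / 6 \<le> norm (K w)"
proof -
  have G_sub: "G \<subseteq> - X" and conG: "connected G" and opG: "open G"
    using G X(1) in_components_subset in_components_connected open_components by blast+
  \<comment> \<open>The complement of G is connected and contains the unbounded X, so its only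
    component is unbounded. This makes G simply connected and provides the square root.\<close>
  have "connected (- G)"
    using component_complement_connected[OF X(2) G] .
  moreover have "\<not> bounded (- G)"
    using X(3) G_sub bounded_subset by blast
  moreover have "C = - G" if "C \<in> components (- G)" for C
    by (metis calculation(1) that components_eq_sing_iff components_empty empty_iff singletonD)
  ultimately have sc: "simply_connected G"
    using simply_connected_eq_unbounded_complement_components[OF opG] conG by metis
  have hol: "(\<lambda>w. 1 - w / p) holomorphic_on G"
    using p(3) by (intro holomorphic_intros)
  have nz: "1 - w / p \<noteq> 0" if "w \<in> G" for w
    using that G_sub p(1,3) by (auto simp: field_simps)
  obtain g0 where g0: "g0 holomorphic_on G" "\<And>w. w \<in> G \<Longrightarrow> 1 - w / p = (g0 w)\<^sup>2"
    using simply_connected_imp_holomorphic_sqrt[OF hol sc open_imp_locally_path_connected[OF opG] nz] by metis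
  \<comment> \<open>The factor \<open>g0 0\<close> is 1 or -1, which normalises g to be 1 at the
    origin. If the origin is not in G, then G has no point of modulus below |p|, and either branch
    serves.\<close>
  define g where "g = (\<lambda>w. (if 0 \<in> G then g0 0 else 1) * g0 w)"
  have g_hol: "g holomorphic_on G"
    unfolding g_def by (intro holomorphic_intros g0)
  have g_sq: "(g w)\<^sup>2 = 1 - w / p" if "w \<in> G" for w
    using g0(2)[OF that] g0(2)[of 0] by (auto simp: g_def power_mult_distrib)
  have g_0: "g 0 = 1" if "0 \<in> G"
    using g0(2)[OF that] that by (auto simp: g_def power2_eq_square)
  \<comment> \<open>G contains the disc |w| < |p| as soon as it meets it. There 1 - w/p has positive
    real part, so g never meets the imaginary axis and stays on the side of its value 1 at the
    origin.\<close>
  have re_pos: "Re (g w) > 0" if w: "w \<in> G" "norm w < norm p" for w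
  proof -
    have "ball 0 (norm p) \<subseteq> - X"
      using p(2) by fastforce
    moreover have "w \<in> ball 0 (norm p) \<inter> G" using w by auto
    ultimately have B: "ball 0 (norm p) \<subseteq> G"
      using components_maximal[OF G, of "ball 0 (norm p)"] by blast
    then have G0: "0 \<in> G" using p(3) by auto
    have ne: "Re (g v) \<noteq> 0" if v: "v \<in> ball 0 (norm p)" for v
    proof
      assume "Re (g v) = 0"
      then have "Re ((g v)\<^sup>2) \<le> 0" by (simp add: power2_eq_square)
      then have "Re (v / p) \<ge> 1" using g_sq v B by auto
      moreover have "Re (v / p) < 1"
      proof -
        have "norm (v / p) < 1" using v p(3) by (simp add: norm_divide)
        then show ?thesis using complex_Re_le_cmod[of "v / p"] by linarith
      qed
      ultimately show False by simp
    qed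
    have "connected ((\<lambda>v. Re (g v)) ` ball 0 (norm p))"
      using holomorphic_on_subset[OF g_hol B]
      by (intro connected_continuous_image continuous_intros holomorphic_on_imp_continuous_on) auto
    then have "Re (g w) > 0 \<or> 0 \<in> (\<lambda>v. Re (g v)) ` ball 0 (norm p)"
      using connectedD_interval[of "(\<lambda>v. Re (g v)) ` ball 0 (norm p)" "Re (g w)" "Re (g 0)" 0]
        imageI[of 0 "ball 0 (norm p)" "\<lambda>v. Re (g v)"] g_0[OF G0] w p(3)
      by (cases "Re (g w) \<le> 0") auto
    then show ?thesis using ne by auto
  qed
  \<comment> \<open>If g were closer to -1, then |w/p| = |g + 1| |g - 1| would be at most 24/25, and
    Re g > 0 by \<open>re_pos\<close>, a contradiction. The bound 2/5 yields the constants 6 = 1 +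
    2/(2/5) and 7 > 1/(2/5)^2.\<close>
  have far: "norm (g w + 1) \<ge> 2 / 5" if w: "w \<in> G" for w
  proof (rule ccontr)
    assume neg: "\<not> norm (g w + 1) \<ge> 2 / 5"
    have "w / p = - ((g w + 1) * (g w - 1))"
      using g_sq[OF w] by (simp add: power2_eq_square algebra_simps)
    then have "norm w / norm p = norm (g w + 1) * norm (g w - 1)"
      by (metis norm_divide norm_minus_cancel norm_mult)
    also have "\<dots> \<le> (2/5) * (2/5 + 2)"
    proof (rule mult_mono)
      show "norm (g w - 1) \<le> 2/5 + 2"
        using norm_triangle_ineq4[of "g w + 1" 2] neg by simp
    qed (use neg in auto)
    also have "\<dots> < 1" by simp
    finally have "norm w < norm p" using p(3) by simp
    then have "Re (g w) > 0" using re_pos w by blast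
    then show False
      using neg complex_Re_le_cmod[of "g w + 1"] by simp
  qed
  define K where "K = (\<lambda>w. (g w - 1) / (g w + 1))"
  have nz1: "g w + 1 \<noteq> 0" if "w \<in> G" for w
    using far[OF that] by auto
  have K_eq: "norm (K w) = (norm w / norm p) / (norm (g w + 1))\<^sup>2" if w: "w \<in> G" for w
  proof -
    have "K w = - (w / p) / (g w + 1)\<^sup>2"
    proof -
      have "- (w / p) = (g w + 1) * (g w - 1)"
        using g_sq[OF w] by (simp add: power2_eq_square algebra_simps)
      then show ?thesis using nz1[OF w] by (simp add: K_def power2_eq_square)
    qed
    then show ?thesis by (simp add: norm_divide norm_power norm_mult)
  qed
  show ?thesis
  proof
    show "K holomorphic_on G"
      unfolding K_def using nz1 by (intro holomorphic_intros g_hol) auto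
  next
    fix w assume w: "w \<in> G"
    have "K w = 1 - 2 / (g w + 1)"
      using nz1[OF w] by (simp add: K_def field_simps)
    then have "norm (K w) \<le> 1 + norm (2 / (g w + 1))"
      using norm_triangle_ineq4[of 1 "2 / (g w + 1)"] by simp
    also have "norm (2 / (g w + 1)) \<le> 2 / (2 / 5)"
      unfolding norm_divide using far[OF w] by (intro frac_le) auto
    finally show "norm (K w) \<le> 6" by simp
    have "(2/5)\<^sup>2 \<le> (norm (g w + 1))\<^sup>2"
      using far[OF w] by (intro power_mono) auto
    then have "norm (K w) \<le> (norm w / norm p) / (2/5)\<^sup>2"
      unfolding K_eq[OF w] by (intro divide_left_mono) (auto simp: nz1[OF w])
    also have "\<dots> \<le> 7 * norm w / norm p"
      using p(3) by (simp add: power2_eq_square field_simps)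
    finally show "norm (K w) \<le> 7 * norm w / norm p" .
    assume wp: "norm p \<le> norm w"
    define \<tau> where "\<tau> = norm w / norm p"
    have \<tau>: "\<tau> \<ge> 1" using wp p(3) by (simp add: \<tau>_def)
    have "(norm (g w))\<^sup>2 = norm (1 - w / p)"
      by (metis g_sq[OF w] norm_power)
    also have "\<dots> \<le> 1 + \<tau>"
      using norm_triangle_ineq4[of 1 "w / p"] by (simp add: \<tau>_def norm_divide)
    finally have a: "(norm (g w))\<^sup>2 \<le> 1 + \<tau>" .
    have "(norm (g w + 1))\<^sup>2 \<le> (norm (g w) + 1)\<^sup>2"
      using norm_triangle_ineq[of "g w" 1] by (intro power_mono) auto
    also have "\<dots> \<le> 2 * (norm (g w))\<^sup>2 + 2"
      using zero_le_power2[of "norm (g w) - 1"] by (simp add: power2_eq_square algebra_simps)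
    finally have "(norm (g w + 1))\<^sup>2 \<le> 6 * \<tau>" using a \<tau> by linarith
    moreover have "norm (K w) = \<tau> / (norm (g w + 1))\<^sup>2"
      using K_eq[OF w] by (simp add: \<tau>_def)
    moreover have "\<tau> / (6 * \<tau>) = 1 / 6" using \<tau> by simp
    ultimately show "1 / 6 \<le> norm (K w)"
      using \<tau> nz1[OF w] divide_left_mono[of "(norm (g w + 1))\<^sup>2" "6 * \<tau>" \<tau>] by simp
  qed
qed

section \<open>The maximum modulus of a tract\<close>

text \<open>Requiring every large circle to meet D makes the supremum in \<open>MD\<close> one over
  a nonempty set, so its value is a genuine maximum modulus.\<close>

locale growing_tract =
  fixes f :: "complex \<Rightarrow> complex" and D :: "complex set" and R \<rho>0 :: real
  assumes tract: "direct_tract f D R"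
    and R_less: "\<rho>0 > R"
    and growing: "\<forall>\<rho>>\<rho>0. D \<inter> sphere 0 \<rho> \<noteq> {} \<and> MD f D \<rho> > \<rho>"
begin

abbreviation M :: "real \<Rightarrow> real" where "M \<equiv> MD f D"

lemma open_D: "open D" and unbounded_compl: "\<not> bounded (- D)"
  and holomorphic: "f holomorphic_on D" and cont_closure: "continuous_on (closure D) f"
  and R_pos: "R > 0" and norm_frontier: "z \<in> frontier D \<Longrightarrow> norm (f z) = R"
  and norm_gt: "z \<in> D \<Longrightarrow> norm (f z) > R"
  using tract by (auto simp: direct_tract_def)

lemma norm_closure_diff: "z \<in> closure D \<Longrightarrow> z \<notin> D \<Longrightarrow> norm (f z) = R"
  using norm_frontier open_D by (simp add: frontier_def interior_open)

lemma M_greater: "r > \<rho>0 \<Longrightarrow> M r > r"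
  using growing by blast

lemma norm_le_M_sphere:
  assumes "z \<in> D" "norm z = r"
  shows "norm (f z) \<le> M r"
proof -
  have "compact (closure D \<inter> sphere 0 r)"
    by (intro closed_Int_compact) auto
  then have "compact ((\<lambda>z. norm (f z)) ` (closure D \<inter> sphere 0 r))"
    by (intro compact_continuous_image continuous_intros continuous_on_subset[OF cont_closure]) auto
  then have "bdd_above ((\<lambda>z. norm (f z)) ` (D \<inter> sphere 0 r))"
    using closure_subset by (intro bdd_above_mono[OF bounded_imp_bdd_above[OF compact_imp_bounded]]) auto
  then show ?thesis
    unfolding MD_def using assms by (intro cSUP_upper) auto
qed

text \<open>Maximum principle on the part of D inside the circle: a frontier point lies in D on the
  circle itself, or outside D, where |f| = R < \<rho>0 < r < M(r).\<close>

lemma norm_le_M: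
  assumes "r > \<rho>0" "z \<in> D" "norm z \<le> r"
  shows "norm (f z) \<le> M r"
proof (cases "norm z = r")
  case False
  let ?S = "D \<inter> ball 0 r"
  have "open ?S" using open_D by blast
  have cl: "closure ?S \<subseteq> closure D \<inter> cball 0 r"
    using closure_subset by (intro closure_minimal) auto
  show ?thesis
  proof (rule maximum_modulus_frontier[of f ?S])
    show "f holomorphic_on interior ?S"
      using interior_subset by (intro holomorphic_on_subset[OF holomorphic]) blast
    show "continuous_on (closure ?S) f"
      using cl by (intro continuous_on_subset[OF cont_closure]) blast
    show "z \<in> ?S" using assms False by auto
    fix y assume y: "y \<in> frontier ?S"
    then have y': "y \<in> closure D" "norm y \<le> r" "y \<notin> ?S"
      using cl interior_open[OF \<open>open ?S\<close>] by (auto simp: frontier_def)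
    show "norm (f y) \<le> M r"
    proof (cases "y \<in> D")
      case True
      then show ?thesis using y' by (intro norm_le_M_sphere) auto
    next
      case False
      then show ?thesis using norm_closure_diff y' M_greater[OF assms(1)] assms(1) R_less by auto
    qed
  qed (auto intro: bounded_Int)
qed (use norm_le_M_sphere assms in auto)

lemma M_mono:
  assumes "\<rho>0 < r" "r \<le> s" shows "M r \<le> M s"
  unfolding MD_def[of f D r]
  using growing assms by (intro cSUP_least) (auto intro!: norm_le_M)

lemma less_M_obtain:
  assumes "\<rho>0 < r" "y < M r"
  obtains z where "z \<in> D" "norm z = r" "y < norm (f z)"
proof -
  have "\<exists>v \<in> (\<lambda>z. norm (f z)) ` (D \<inter> sphere 0 r). y < v"
    using assms growing less_cSupD[of "(\<lambda>z. norm (f z)) ` (D \<inter> sphere 0 r)" y]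
    by (auto simp: MD_def)
  then show ?thesis using that by auto
qed

section \<open>Superquadratic growth of the maximum modulus\<close>

definition logder :: "complex \<Rightarrow> complex" where
  "logder \<zeta> = deriv f (exp \<zeta>) * exp \<zeta> / f (exp \<zeta>)"

text \<open>The logarithm of |f| / (R e^a): height 0 is the level set |f| = R e^a, which for a > 0
  stays off the boundary of D.\<close>

definition height :: "real \<Rightarrow> complex \<Rightarrow> real" where
  "height a \<zeta> = ln (norm (f (exp \<zeta>))) - ln R - a"

definition lift :: "(complex \<Rightarrow> real) \<Rightarrow> complex \<Rightarrow> real" where
  "lift h \<zeta> = (if exp \<zeta> \<in> D then h \<zeta> else 0)"

lemma open_exp_vimage: "open {\<zeta>. exp \<zeta> \<in> D}"
  using continuous_open_vimage[OF open_D, of exp] by (auto simp: vimage_def)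

lemma f_exp_nz: "exp \<zeta> \<in> D \<Longrightarrow> f (exp \<zeta>) \<noteq> 0"
  using norm_gt[of "exp \<zeta>"] R_pos by auto

lemma holomorphic_f_exp: "(\<lambda>\<zeta>. f (exp \<zeta>)) holomorphic_on {\<zeta>. exp \<zeta> \<in> D}"
  using holomorphic_on_compose_gen[OF holomorphic_on_exp holomorphic, of "{\<zeta>. exp \<zeta> \<in> D}"]
  by (auto simp: o_def)

lemma holomorphic_logder: "logder holomorphic_on {\<zeta>. exp \<zeta> \<in> D}"
proof -
  have "(\<lambda>\<zeta>. deriv f (exp \<zeta>)) holomorphic_on {\<zeta>. exp \<zeta> \<in> D}"
    using holomorphic_on_compose_gen[OF holomorphic_on_exp holomorphic_deriv[OF holomorphic open_D],
        of "{\<zeta>. exp \<zeta> \<in> D}"] by (auto simp: o_def)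
  then show ?thesis
    unfolding logder_def using f_exp_nz
    by (intro holomorphic_intros holomorphic_f_exp) auto
qed

lemma continuous_on_height: "continuous_on {\<zeta>. exp \<zeta> \<in> D} (height a)"
  unfolding height_def using f_exp_nz
  by (intro continuous_intros holomorphic_on_imp_continuous_on holomorphic_f_exp) auto

text \<open>A point of the closure of D with |f| \<ge> R e^a > R cannot be a boundary point, so the
  set is the preimage of a closed set. The lifted functions below vanish on its open complement,
  which makes extension by zero preserve continuity and derivatives.\<close>

lemma closed_height_nonneg:
  assumes "a > 0"
  shows "closed {\<zeta>. exp \<zeta> \<in> D \<and> height a \<zeta> \<ge> 0}"
proof -
  let ?T = "{z \<in> closure D. f z \<in> - ball 0 (R * exp a)}"
  have "closed ?T"
    using continuous_closed_preimage[OF cont_closure closed_closure, of "- ball 0 (R * exp a)"]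
    by (auto simp: vimage_def Int_def)
  then have "closed (exp -` ?T)"
    by (intro continuous_closed_vimage) auto
  moreover have "exp \<zeta> \<in> D \<and> height a \<zeta> \<ge> 0 \<longleftrightarrow> exp \<zeta> \<in> ?T" for \<zeta>
  proof (cases "exp \<zeta> \<in> D")
    case True
    then have "height a \<zeta> \<ge> 0 \<longleftrightarrow> ln (R * exp a) \<le> ln (norm (f (exp \<zeta>)))"
      using R_pos by (auto simp: height_def ln_mult)
    also have "\<dots> \<longleftrightarrow> R * exp a \<le> norm (f (exp \<zeta>))"
      using R_pos f_exp_nz[OF True] by (intro ln_le_cancel_iff) auto
    finally show ?thesis using True closure_subset by auto
  next
    case False
    have "R < R * exp a" using R_pos assms by simp
    then show ?thesis using False norm_closure_diff by auto
  qed
  ultimately show ?thesis by (simp add: vimage_def)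
qed

lemma continuous_on_lift:
  assumes "a > 0" "continuous_on {\<zeta>. exp \<zeta> \<in> D} h"
    "\<And>\<zeta>. exp \<zeta> \<in> D \<Longrightarrow> height a \<zeta> \<le> 0 \<Longrightarrow> h \<zeta> = 0"
  shows "continuous_on UNIV (lift h)"
proof -
  let ?N = "- {\<zeta>. exp \<zeta> \<in> D \<and> height a \<zeta> \<ge> 0}"
  have "continuous_on ({\<zeta>. exp \<zeta> \<in> D} \<union> ?N) (lift h)"
  proof (rule continuous_on_open_Un)
    show "open ?N" using closed_height_nonneg[OF assms(1)] by (simp add: open_Compl)
    show "continuous_on {\<zeta>. exp \<zeta> \<in> D} (lift h)"
      using assms(2) by (rule continuous_on_eq) (auto simp: lift_def)
    show "continuous_on ?N (lift h)"
      by (rule continuous_on_eq[of _ "\<lambda>_. 0"]) (auto simp: lift_def assms(3))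
  qed (rule open_exp_vimage)
  moreover have "{\<zeta>. exp \<zeta> \<in> D} \<union> ?N = UNIV" by auto
  ultimately show ?thesis by simp
qed

lemma lift_has_derivative:
  assumes "a > 0" "\<And>\<zeta>. exp \<zeta> \<in> D \<Longrightarrow> height a \<zeta> \<le> 0 \<Longrightarrow> h \<zeta> = 0"
    and "\<And>\<zeta> t. \<zeta> = c + of_real t * d \<Longrightarrow> exp \<zeta> \<in> D \<Longrightarrow>
      ((\<lambda>t. h (c + of_real t * d)) has_real_derivative h' \<zeta>) (at t)"
  shows "((\<lambda>t. lift h (c + of_real t * d)) has_real_derivative lift h' (c + of_real t * d)) (at t)"
proof -
  have cont: "continuous_on UNIV (\<lambda>t. c + of_real t * d)" by (intro continuous_intros)
  show ?thesis
  proof (cases "exp (c + of_real t * d) \<in> D")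
    case True
    let ?T = "(\<lambda>t. c + of_real t * d) -` {\<zeta>. exp \<zeta> \<in> D}"
    have "open ?T"
      using open_exp_vimage cont by (rule open_vimage)
    moreover have "lift h (c + of_real s * d) = h (c + of_real s * d)" if "s \<in> ?T" for s
      using that by (simp add: lift_def)
    ultimately have "((\<lambda>t. lift h (c + of_real t * d)) has_real_derivative h' (c + of_real t * d)) (at t)"
      using True by (intro has_field_derivative_transform_within_open[OF assms(3)[OF refl True], of ?T]) auto
    then show ?thesis using True by (simp add: lift_def)
  next
    case False
    let ?N = "- {\<zeta>. exp \<zeta> \<in> D \<and> height a \<zeta> \<ge> 0}"
    let ?T = "(\<lambda>t. c + of_real t * d) -` ?N"
    have "open ?T"
      using closed_height_nonneg[OF assms(1)] cont by (intro open_vimage open_Compl)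
    moreover have "0 = lift h (c + of_real s * d)" if "s \<in> ?T" for s
      using that assms(2)[of "c + of_real s * d"] by (auto simp: lift_def)
    ultimately have "((\<lambda>t. lift h (c + of_real t * d)) has_real_derivative 0) (at t)"
      using False by (intro has_field_derivative_transform_within_open[OF DERIV_const, of ?T]) auto
    then show ?thesis using False by (simp add: lift_def)
  qed
qed

lemma f_exp_has_derivative:
  assumes "\<zeta> = c + of_real t * d" "exp \<zeta> \<in> D"
  shows "((\<lambda>t. f (exp (c + of_real t * d))) has_vector_derivative
    logder \<zeta> * d * f (exp \<zeta>)) (at t)"
proof -
  have "(f has_field_derivative deriv f (exp \<zeta>)) (at (exp \<zeta>))"
    using holomorphic_derivI[OF holomorphic open_D assms(2)] .
  then have "((\<lambda>\<zeta>. f (exp \<zeta>)) has_field_derivative deriv f (exp \<zeta>) * exp \<zeta>) (at \<zeta>)"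
    by (rule DERIV_chain2) (rule DERIV_exp)
  moreover have "((\<lambda>t. c + of_real t * d) has_vector_derivative d) (at t)"
    by (auto intro!: derivative_eq_intros)
  ultimately have "((\<lambda>t. f (exp (c + of_real t * d))) has_vector_derivative
      d * (deriv f (exp \<zeta>) * exp \<zeta>)) (at t)"
    using field_vector_diff_chain_at[of "\<lambda>t. c + of_real t * d" d t "\<lambda>\<zeta>. f (exp \<zeta>)" "deriv f (exp \<zeta>) * exp \<zeta>"]
    by (simp add: o_def assms(1))
  then show ?thesis using f_exp_nz[OF assms(2)] by (simp add: logder_def mult_ac)
qed

lemma height_has_derivative:
  assumes "\<zeta> = c + of_real t * d" "exp \<zeta> \<in> D"
  shows "((\<lambda>t. height a (c + of_real t * d)) has_real_derivative Re (logder \<zeta> * d)) (at t)"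
proof -
  have "((\<lambda>t. ln (norm (f (exp (c + of_real t * d))))) has_real_derivative
      Re (logder \<zeta> * d * f (exp \<zeta>) / f (exp (c + of_real t * d)))) (at t)"
    using f_exp_has_derivative[OF assms] f_exp_nz[OF assms(2)] assms(1)
    by (intro has_real_derivative_ln_norm) auto
  from DERIV_diff[OF this DERIV_const[of "ln R + a"]] show ?thesis
    using f_exp_nz[OF assms(2)] assms(1) by (simp add: height_def diff_diff_eq)
qed

lemma logder_has_derivative:
  assumes "\<zeta> = c + of_real t * d" "exp \<zeta> \<in> D"
  shows "((\<lambda>t. Re (logder (c + of_real t * d) * e)) has_real_derivative Re (deriv logder \<zeta> * d * e)) (at t)"
proof -
  have "(logder has_field_derivative deriv logder \<zeta>) (at \<zeta>)"
    using holomorphic_derivI[OF holomorphic_logder open_exp_vimage] assms(2) by simp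
  moreover have "((\<lambda>t. c + of_real t * d) has_vector_derivative d) (at t)"
    by (auto intro!: derivative_eq_intros)
  ultimately have "((\<lambda>t. logder (c + of_real t * d)) has_vector_derivative d * deriv logder \<zeta>) (at t)"
    using field_vector_diff_chain_at[of "\<lambda>t. c + of_real t * d" d t logder "deriv logder \<zeta>"]
    by (simp add: o_def assms(1))
  then have "((\<lambda>t. logder (c + of_real t * d) * e) has_vector_derivative d * deriv logder \<zeta> * e) (at t)"
    by (rule has_vector_derivative_mult_left)
  then have "((\<lambda>t. Re (logder (c + of_real t * d) * e)) has_vector_derivative Re (d * deriv logder \<zeta> * e)) (at t)"
    by (rule bounded_linear.has_vector_derivative[OF bounded_linear_Re])
  then show ?thesis by (simp add: has_real_derivative_iff_has_vector_derivative mult_ac)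
qed

section \<open>Circular means, flux and energy\<close>

definition flux_integrand :: "real \<Rightarrow> complex \<Rightarrow> complex \<Rightarrow> real" where
  "flux_integrand a e = lift (\<lambda>\<zeta>. cutoff' (height a \<zeta>) * Re (logder \<zeta> * e))"

definition flux :: "real \<Rightarrow> real \<Rightarrow> real" where
  "flux a x = integral {0..2*pi} (\<lambda>\<theta>. flux_integrand a 1 (of_real x + of_real \<theta> * \<i>))"

text \<open>2 pi times the mean of the subharmonic function \<open>cutoff (height a \<zeta>)\<close>
  on the circle of radius e^x. \<open>flux_integrand a e\<close> is the derivative of that function
  in direction e, \<open>flux\<close> the derivative of the potential, and \<open>energy\<close> the
  integral of the Laplacian.\<close>

definition potential :: "real \<Rightarrow> real \<Rightarrow> real" where
  "potential a x = integral {0..2*pi} (\<lambda>\<theta>. lift (\<lambda>\<zeta>. cutoff (height a \<zeta>)) (of_real x + of_real \<theta> * \<i>))"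

definition energy :: "real \<Rightarrow> real \<Rightarrow> real" where
  "energy a x = integral {0..2*pi}
     (\<lambda>\<theta>. lift (\<lambda>\<zeta>. cutoff'' (height a \<zeta>) * (norm (logder \<zeta>))\<^sup>2) (of_real x + of_real \<theta> * \<i>))"

lemma continuous_on_logder: "continuous_on {\<zeta>. exp \<zeta> \<in> D} logder"
  and continuous_on_deriv_logder: "continuous_on {\<zeta>. exp \<zeta> \<in> D} (deriv logder)"
  using holomorphic_logder holomorphic_deriv[OF holomorphic_logder open_exp_vimage]
  by (auto intro: holomorphic_on_imp_continuous_on)

lemma continuous_on_cutoff_height:
  "continuous_on {\<zeta>. exp \<zeta> \<in> D} (\<lambda>\<zeta>. cutoff (height a \<zeta>))"
  "continuous_on {\<zeta>. exp \<zeta> \<in> D} (\<lambda>\<zeta>. cutoff' (height a \<zeta>))"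
  "continuous_on {\<zeta>. exp \<zeta> \<in> D} (\<lambda>\<zeta>. cutoff'' (height a \<zeta>))"
  by (rule continuous_on_compose2[OF continuous_on_cutoff(1) continuous_on_height]
      continuous_on_compose2[OF continuous_on_cutoff(2) continuous_on_height]
      continuous_on_compose2[OF continuous_on_cutoff(3) continuous_on_height]; blast)+

lemmas lift_continuous_intros = continuous_on_lift continuous_on_cutoff_height continuous_on_logder
  continuous_on_deriv_logder

lemma continuous_on_circle:
  assumes "continuous_on UNIV h"
  shows "continuous_on A (\<lambda>\<theta>::real. h (of_real x + of_real \<theta> * \<i>))"
  by (intro continuous_on_compose2[OF assms] continuous_intros) auto

lemma continuous_on_energy_density:
  "a > 0 \<Longrightarrow> continuous_on UNIV (lift (\<lambda>\<zeta>. cutoff'' (height a \<zeta>) * (norm (logder \<zeta>))\<^sup>2))"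
  by (intro lift_continuous_intros continuous_intros) auto

lemma continuous_on_flux_integrand:
  "a > 0 \<Longrightarrow> continuous_on UNIV (flux_integrand a e)"
  unfolding flux_integrand_def by (intro lift_continuous_intros continuous_intros) auto

lemma flux_integrand_has_derivative:
  assumes "a > 0"
  shows "((\<lambda>t. flux_integrand a e (c + of_real t * d)) has_real_derivative
    lift (\<lambda>\<zeta>. cutoff'' (height a \<zeta>) * Re (logder \<zeta> * d) * Re (logder \<zeta> * e) +
      Re (deriv logder \<zeta> * d * e) * cutoff' (height a \<zeta>)) (c + of_real t * d)) (at t)"
  unfolding flux_integrand_def
proof (rule lift_has_derivative[OF assms])
  fix \<zeta> t assume \<zeta>: "\<zeta> = c + of_real t * d" "exp \<zeta> \<in> D"
  show "((\<lambda>t. cutoff' (height a (c + of_real t * d)) * Re (logder (c + of_real t * d) * e))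
    has_real_derivative cutoff'' (height a \<zeta>) * Re (logder \<zeta> * d) * Re (logder \<zeta> * e) +
      Re (deriv logder \<zeta> * d * e) * cutoff' (height a \<zeta>)) (at t)"
    using DERIV_mult[OF DERIV_chain2[OF cutoff'_has_derivative height_has_derivative[OF \<zeta>]]
        logder_has_derivative[OF \<zeta>]] \<zeta>(1) by simp
qed simp

lemma potential_has_derivative:
  assumes "a > 0"
  shows "(potential a has_real_derivative flux a x) (at x)"
proof -
  have "((\<lambda>t. lift (\<lambda>\<zeta>. cutoff (height a \<zeta>)) (c + of_real t * 1)) has_real_derivative
    flux_integrand a 1 (c + of_real t * 1)) (at t)" for c t
    unfolding flux_integrand_def
  proof (rule lift_has_derivative[OF assms])
    fix \<zeta> t assume \<zeta>: "\<zeta> = c + of_real t * 1" "exp \<zeta> \<in> D"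
    show "((\<lambda>t. cutoff (height a (c + of_real t * 1))) has_real_derivative
      cutoff' (height a \<zeta>) * Re (logder \<zeta> * 1)) (at t)"
      using DERIV_chain2[OF cutoff_has_derivative height_has_derivative[OF \<zeta>]] \<zeta>(1) by simp
  qed simp
  then have "((\<lambda>t. lift (\<lambda>\<zeta>. cutoff (height a \<zeta>)) (c + of_real t)) has_real_derivative
    flux_integrand a 1 (c + of_real t)) (at t)" for c t
    by simp
  moreover have "continuous_on UNIV (lift (\<lambda>\<zeta>. cutoff (height a \<zeta>)))"
    using assms by (intro lift_continuous_intros) auto
  ultimately show ?thesis
    unfolding potential_def[abs_def] flux_def
    by (intro circle_integral_has_derivative continuous_on_flux_integrand assms)
qed

text \<open>The divergence theorem on the circle: since \<^term>\<open>ln (norm (f (exp \<zeta>)))\<close> is harmonic,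
  the second-order terms cancel after integrating by parts in the angular variable.\<close>

lemma flux_has_derivative:
  assumes "a > 0"
  shows "(flux a has_real_derivative energy a x) (at x)"
proof -
  let ?V = "\<lambda>d. lift (\<lambda>\<zeta>. cutoff'' (height a \<zeta>) * Re (logder \<zeta> * d) * Re (logder \<zeta> * d) +
      Re (deriv logder \<zeta> * d * d) * cutoff' (height a \<zeta>))"
  let ?p = "\<lambda>\<theta>::real. complex_of_real x + of_real \<theta> * \<i>"
  have contV: "continuous_on UNIV (?V d)" for d
    using assms by (intro lift_continuous_intros continuous_intros) auto
  have "((\<lambda>t. flux_integrand a 1 (c + of_real t)) has_real_derivative ?V 1 (c + of_real t)) (at t)" for c t
    using flux_integrand_has_derivative[OF assms, of 1 c 1 t] by simp
  from circle_integral_has_derivative[OF continuous_on_flux_integrand[OF assms] contV this]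
  have 1: "(flux a has_real_derivative integral {0..2*pi} (\<lambda>\<theta>. ?V 1 (?p \<theta>))) (at x)"
    by (simp add: flux_def[abs_def])
  have "((\<lambda>\<theta>. ?V \<i> (?p \<theta>)) has_integral
      flux_integrand a \<i> (?p (2*pi)) - flux_integrand a \<i> (?p 0)) {0..2*pi}"
    using flux_integrand_has_derivative[OF assms, of \<i> "of_real x" \<i>]
    by (intro fundamental_theorem_of_calculus)
      (auto simp: has_real_derivative_iff_has_vector_derivative[symmetric] intro: has_field_derivative_at_within)
  \<comment> \<open>Both ends of the segment are the same point of the circle, so the second angular
    derivative integrates to 0.\<close>
  moreover have "exp (?p (2*pi)) = exp (?p 0)"
    by (simp add: exp_add exp_of_real mult.commute)
  then have "flux_integrand a \<i> (?p (2*pi)) = flux_integrand a \<i> (?p 0)"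
    unfolding flux_integrand_def lift_def height_def logder_def by presburger
  ultimately have "((\<lambda>\<theta>. ?V \<i> (?p \<theta>)) has_integral 0) {0..2*pi}" by simp
  moreover have "((\<lambda>\<theta>. ?V 1 (?p \<theta>)) has_integral integral {0..2*pi} (\<lambda>\<theta>. ?V 1 (?p \<theta>))) {0..2*pi}"
    by (intro integrable_integral integrable_continuous_interval continuous_on_circle contV)
  ultimately have "((\<lambda>\<theta>. ?V 1 (?p \<theta>) + ?V \<i> (?p \<theta>)) has_integral
      integral {0..2*pi} (\<lambda>\<theta>. ?V 1 (?p \<theta>)) + 0) {0..2*pi}"
    using has_integral_add by blast
  \<comment> \<open>The terms with \<open>deriv logder\<close> cancel because i^2 = -1, and the
    squares of Re L and Re (L i) = - Im L add up to |L|^2, where L =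
    \<open>logder \<zeta>\<close>.\<close>
  moreover have "?V 1 \<zeta> + ?V \<i> \<zeta> = lift (\<lambda>\<zeta>. cutoff'' (height a \<zeta>) * (norm (logder \<zeta>))\<^sup>2) \<zeta>" for \<zeta>
    unfolding lift_def cmod_power2 by (simp add: power2_eq_square algebra_simps)
  ultimately have "energy a x = integral {0..2*pi} (\<lambda>\<theta>. ?V 1 (?p \<theta>))"
    unfolding energy_def by (simp add: integral_unique)
  then show ?thesis using 1 by simp
qed

lemma energy_nonneg: "0 \<le> energy a x"
  unfolding energy_def
  \<comment> \<open>If the integrand is not integrable, the integral has the default value
    0.\<close>
  by (cases "(\<lambda>\<theta>. lift (\<lambda>\<zeta>. cutoff'' (height a \<zeta>) * (norm (logder \<zeta>))\<^sup>2) (of_real x + of_real \<theta> * \<i>))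
        integrable_on {0..2*pi}")
     (auto intro!: integral_nonneg simp: lift_def cutoff''_bounds not_integrable_integral)

lemma flux_mono: "a > 0 \<Longrightarrow> x \<le> y \<Longrightarrow> flux a x \<le> flux a y"
  by (rule DERIV_nonneg_imp_nondecreasing) (use flux_has_derivative energy_nonneg in blast)+

text \<open>A circle that leaves the set where \<open>|f|\<close> is large forces the cutoff to vary by a full unit
  along it, and the Cauchy-Schwarz inequality bounds the energy from below.\<close>

lemma energy_ge:
  assumes a: "a > 0" and in01: "\<theta>0 \<in> {0..2*pi}" "\<theta>1 \<in> {0..2*pi}"
    and \<theta>0: "exp (of_real x + of_real \<theta>0 * \<i>) \<notin> D \<or> height a (of_real x + of_real \<theta>0 * \<i>) \<le> 0"
    and \<theta>1: "exp (of_real x + of_real \<theta>1 * \<i>) \<in> D" "height a (of_real x + of_real \<theta>1 * \<i>) \<ge> 2"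
  shows "energy a x \<ge> 1 / (2 * pi)"
proof -
  let ?p = "\<lambda>\<theta>::real. complex_of_real x + of_real \<theta> * \<i>"
  let ?e = "lift (\<lambda>\<zeta>. cutoff'' (height a \<zeta>) * (norm (logder \<zeta>))\<^sup>2)"
  let ?q = "lift (\<lambda>\<zeta>. cutoff'' (height a \<zeta>) * Re (logder \<zeta> * \<i>))"
  let ?c = "lift (\<lambda>\<zeta>. cutoff' (height a \<zeta>))"
  have deriv: "((\<lambda>t. ?c (?p t)) has_real_derivative ?q (?p t)) (at t)" for t
  proof (rule lift_has_derivative[OF a])
    fix \<zeta> t assume \<zeta>: "\<zeta> = of_real x + of_real t * \<i>" "exp \<zeta> \<in> D"
    show "((\<lambda>t. cutoff' (height a (of_real x + of_real t * \<i>))) has_real_derivative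
      cutoff'' (height a \<zeta>) * Re (logder \<zeta> * \<i>)) (at t)"
      using DERIV_chain2[OF cutoff'_has_derivative height_has_derivative[OF \<zeta>]] \<zeta>(1) by simp
  qed simp
  \<comment> \<open>The inequality y \<le> pi y^2 + 1/(4 pi), weighted by \<open>cutoff''\<close>,
    which lies in [0,1]. The constant integrates to 1/2 over the circle, so a variation of 1 leaves
    at least 1/2 for pi times the energy.\<close>
  have bound: "\<bar>?q \<zeta>\<bar> \<le> pi * ?e \<zeta> + 1 / (4 * pi)" for \<zeta>
  proof (cases "exp \<zeta> \<in> D")
    case True
    define k y where "k = cutoff'' (height a \<zeta>)" and "y = norm (logder \<zeta>)"
    have k: "0 \<le> k" "k \<le> 1" by (simp_all add: k_def cutoff''_bounds)
    have "y \<le> pi * y\<^sup>2 + 1 / (4 * pi)"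
    proof -
      have "0 \<le> (2 * pi * y - 1)\<^sup>2 / (4 * pi)" by simp
      also have "\<dots> = pi * y\<^sup>2 + 1 / (4 * pi) - y" by (simp add: field_simps power2_eq_square)
      finally show ?thesis by simp
    qed
    then have "k * y \<le> k * (pi * y\<^sup>2 + 1 / (4 * pi))"
      using k by (intro mult_left_mono) auto
    also have "\<dots> \<le> pi * (k * y\<^sup>2) + 1 / (4 * pi)"
      using mult_right_mono[OF k(2), of "1 / (4 * pi)"] by (simp add: algebra_simps)
    finally have "k * y \<le> pi * (k * y\<^sup>2) + 1 / (4 * pi)" .
    moreover have "\<bar>Re (logder \<zeta> * \<i>)\<bar> \<le> y" unfolding y_def using abs_Im_le_cmod by simp
    then have "\<bar>k * Re (logder \<zeta> * \<i>)\<bar> \<le> k * y"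
      unfolding abs_mult using k by (simp add: mult_left_mono)
    ultimately show ?thesis using True by (simp add: lift_def k_def y_def)
  qed (simp add: lift_def)
  have conte: "continuous_on A (\<lambda>t. ?e (?p t))" for A
    by (intro continuous_on_circle continuous_on_energy_density a)
  have "continuous_on UNIV ?q"
    using a by (intro lift_continuous_intros continuous_intros) auto
  then have "\<bar>?c (?p \<theta>1) - ?c (?p \<theta>0)\<bar> \<le> integral {0..2*pi} (\<lambda>t. pi * ?e (?p t) + 1 / (4 * pi))"
    using in01
    by (intro variation_le_integral[OF deriv bound] continuous_on_circle continuous_intros conte) auto
  also have "\<dots> = pi * energy a x + 1 / 2"
    unfolding energy_def
    by (subst integral_add)
      (auto intro!: integrable_continuous_interval continuous_intros conte)
  also have "?c (?p \<theta>1) = 1" using \<theta>1 by (simp add: lift_def cutoff'_eq_1)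
  also have "?c (?p \<theta>0) = 0" using \<theta>0 by (auto simp: lift_def)
  finally show ?thesis by (simp add: field_simps)
qed

text \<open>On a circle inside the tract the flux counts the winding of \<^term>\<open>f\<close> around the origin.\<close>

lemma flux_full_circle:
  assumes "\<And>\<theta>. \<theta> \<in> {0..2*pi} \<Longrightarrow> exp (of_real x + of_real \<theta> * \<i>) \<in> D
      \<and> height a (of_real x + of_real \<theta> * \<i>) \<ge> 2"
  obtains n :: int where "flux a x = 2 * pi * n"
proof -
  let ?p = "\<lambda>\<theta>::real. complex_of_real x + of_real \<theta> * \<i>"
  let ?l = "\<lambda>\<theta>. logder (?p \<theta>) * \<i>"
  have cont: "continuous_on {0..2*pi} ?l"
    using assms by (intro continuous_intros continuous_on_compose2[OF continuous_on_logder]) auto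
  \<comment> \<open>Up to a constant, \<open>I\<close> is a branch of log f along the circle, since
    f times exp(-I) has derivative 0. As f returns to its initial value, exp(-I(2 pi)) = 1.\<close>
  define I where "I = (\<lambda>\<theta>. integral {0..\<theta>} ?l)"
  have I: "(I has_vector_derivative ?l \<theta>) (at \<theta> within {0..2*pi})" if "\<theta> \<in> {0..2*pi}" for \<theta>
    unfolding I_def using integral_has_vector_derivative[OF cont that] .
  have expI: "((\<lambda>\<theta>. exp (- I \<theta>)) has_vector_derivative - ?l \<theta> * exp (- I \<theta>)) (at \<theta> within {0..2*pi})"
    if "\<theta> \<in> {0..2*pi}" for \<theta>
    using field_vector_diff_chain_within[OF has_vector_derivative_minus[OF I[OF that]]
        has_field_derivative_at_within[OF DERIV_exp]] by (simp add: o_def)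
  have "((\<lambda>\<theta>. f (exp (?p \<theta>)) * exp (- I \<theta>)) has_vector_derivative 0) (at \<theta> within {0..2*pi})"
    if "\<theta> \<in> {0..2*pi}" for \<theta>
    using has_vector_derivative_mult[OF has_vector_derivative_at_within[OF f_exp_has_derivative[OF refl, of "of_real x" \<theta> \<i>]] expI[OF that]]
      assms[OF that] by (simp add: algebra_simps)
  then obtain c where c: "\<And>\<theta>. \<theta> \<in> {0..2*pi} \<Longrightarrow> f (exp (?p \<theta>)) * exp (- I \<theta>) = c"
    using has_vector_derivative_zero_constant[of "{0..2*pi}" "\<lambda>\<theta>. f (exp (?p \<theta>)) * exp (- I \<theta>)"]
    by auto
  have "exp (?p (2*pi)) = exp (?p 0)"
    by (simp add: exp_add exp_of_real mult.commute)
  moreover have "I 0 = 0" by (simp add: I_def)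
  ultimately have "exp (- I (2*pi)) = 1"
    using c[of 0] c[of "2*pi"] assms[of 0] f_exp_nz[of "?p 0"] by simp
  then obtain n :: int where "Im (- I (2*pi)) = 2 * of_int n * pi"
    by (auto simp: exp_eq_1)
  then have "Im (I (2*pi)) = 2 * pi * of_int (- n)" by (simp add: algebra_simps)
  also have "Im (I (2*pi)) = integral {0..2*pi} (\<lambda>\<theta>. Im (?l \<theta>))"
    unfolding I_def using cont
    by (intro integral_linear[OF _ bounded_linear_Im, unfolded o_def, symmetric] integrable_continuous_interval)
  \<comment> \<open>Height at least 2 makes \<open>cutoff'\<close> equal to 1 on the whole circle,
    and Im (L i) = Re L.\<close>
  also have "\<dots> = flux a x"
    unfolding flux_def using assms
    by (intro integral_cong) (auto simp: flux_integrand_def lift_def cutoff'_eq_1)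
  finally show ?thesis using that by blast
qed

section \<open>Slow growth and bounded flux\<close>

lemma M_large_obtain:
  assumes "r > \<rho>0" "r \<ge> y"
  obtains z where "z \<in> D" "norm z = r" "y < norm (f z)"
  using less_M_obtain[of r y] M_greater[of r] assms by force

lemma potential_le:
  assumes x: "exp x > \<rho>0" and a: "a > 0"
  shows "potential a x \<le> 2 * pi * (ln (M (exp x)) - ln R)"
proof -
  let ?B = "ln (M (exp x)) - ln R"
  have M: "M (exp x) > R" using M_greater[OF x] x R_less by simp
  then have B: "?B \<ge> 0" using R_pos by simp
  have "lift (\<lambda>\<zeta>. cutoff (height a \<zeta>)) (of_real x + of_real \<theta> * \<i>) \<le> ?B" for \<theta>
  proof (cases "exp (of_real x + of_real \<theta> * \<i>) \<in> D")
    case True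
    let ?z = "exp (of_real x + of_real \<theta> * \<i>)"
    have "norm (f ?z) \<le> M (exp x)"
      by (rule norm_le_M_sphere[OF True]) (simp add: norm_exp_eq_Re)
    then have "height a (of_real x + of_real \<theta> * \<i>) \<le> ?B"
      using norm_gt[OF True] R_pos a by (simp add: height_def)
        (smt (verit) ln_le_cancel_iff)
    then show ?thesis using cutoff_le_max[of "height a (of_real x + of_real \<theta> * \<i>)"] B True
      by (simp add: lift_def)
  qed (use B in \<open>simp add: lift_def\<close>)
  moreover have "(\<lambda>\<theta>. lift (\<lambda>\<zeta>. cutoff (height a \<zeta>)) (of_real x + of_real \<theta> * \<i>)) integrable_on {0..2*pi}"
    using a by (intro integrable_continuous_interval continuous_on_circle lift_continuous_intros) auto
  ultimately have "potential a x \<le> integral {0..2*pi} (\<lambda>_. ?B)"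
    unfolding potential_def by (intro integral_le) auto
  then show ?thesis by simp
qed

text \<open>The potential is convex in x, its derivative \<open>flux a\<close> being increasing, so
  it lies above its tangent at x.\<close>

lemma flux_le_potential_slope:
  assumes "a > 0" "x \<le> y"
  shows "flux a x * (y - x) \<le> potential a y - potential a x"
proof -
  have "potential a x - flux a x * x \<le> potential a y - flux a x * y"
  proof (rule DERIV_nonneg_imp_nondecreasing[OF assms(2)], intro exI conjI)
    fix t assume t: "x \<le> t" "t \<le> y"
    show "((\<lambda>t. potential a t - flux a x * t) has_real_derivative flux a t - flux a x) (at t)"
      by (rule derivative_eq_intros potential_has_derivative[OF assms(1)] refl | simp)+
    show "0 \<le> flux a t - flux a x" using flux_mono[OF assms(1) t(1)] by simp
  qed
  then show ?thesis by (simp add: algebra_simps)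
qed

text \<open>If M(r) \<le> C r^2 along a sequence, the potential at y = ln r is at most 4 pi y plus a
  constant, by \<open>potential_le\<close>. A convex function with a tangent of slope above 4 pi
  would outgrow this.\<close>

lemma flux_bounded:
  assumes slow: "\<And>r0. \<exists>r\<ge>r0. M r \<le> C * r\<^sup>2" and a: "a > 0"
  shows "flux a x \<le> 4 * pi"
proof (rule ccontr)
  assume neg: "\<not> flux a x \<le> 4 * pi"
  define \<delta> where "\<delta> = flux a x - 4 * pi"
  have \<delta>: "\<delta> > 0" using neg by (simp add: \<delta>_def)
  define K where "K = (2 * pi * (ln \<bar>C\<bar> - ln R) - potential a x + flux a x * x)"
  \<comment> \<open>The bounds place y to the right of x, put e^y beyond \<rho>0, and force \<delta>
    y \<ge> |K| + 1, against the inequality \<delta> y \<le> K derived below.\<close>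
  define y0 where "y0 = Max {x, ln (\<bar>\<rho>0\<bar> + 1), (\<bar>K\<bar> + 1) / \<delta>}"
  obtain r where r: "r \<ge> exp y0" "M r \<le> C * r\<^sup>2" using slow by blast
  define y where "y = ln r"
  have r_pos: "r > 0" using r(1) exp_gt_zero by (rule less_le_trans[rotated])
  have y: "exp y = r" "y \<ge> y0"
    using r(1) r_pos by (auto simp: y_def ln_ge_iff)
  have ys: "y \<ge> x" "y \<ge> ln (\<bar>\<rho>0\<bar> + 1)" "y \<ge> (\<bar>K\<bar> + 1) / \<delta>"
    using y(2) by (auto simp: y0_def)
  have "exp (ln (\<bar>\<rho>0\<bar> + 1)) \<le> exp y" using ys(2) by (simp only: exp_le_cancel_iff)
  then have rho: "exp y > \<rho>0" by simp
  have M: "M r > 0" using M_greater[of r] rho y r_pos by simp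
  then have C: "C > 0" using r(2) r_pos
    by (smt (verit) mult_nonpos_nonneg zero_le_power2)
  have "ln (M r) \<le> ln (C * r\<^sup>2)" using M r(2) C r_pos by (subst ln_le_cancel_iff) auto
  also have "\<dots> = ln C + 2 * y" using C r_pos by (simp add: ln_mult ln_realpow y_def)
  finally have lnM: "ln (M r) \<le> ln C + 2 * y" .
  have "flux a x * (y - x) \<le> potential a y - potential a x"
    by (rule flux_le_potential_slope[OF a ys(1)])
  also have "\<dots> \<le> 2 * pi * (ln (M r) - ln R) - potential a x"
    using potential_le[OF rho a] y by simp
  also have "\<dots> \<le> 2 * pi * (ln C + 2 * y - ln R) - potential a x"
    using lnM by simp
  finally have "flux a x * y \<le> 4 * pi * y + K"
    using C by (simp add: K_def algebra_simps)
  then have "\<delta> * y \<le> K" by (simp add: \<delta>_def algebra_simps)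
  moreover have "\<bar>K\<bar> + 1 \<le> \<delta> * y" using ys(3) \<delta> by (simp add: field_simps)
  ultimately show False by simp
qed

text \<open>Since M(r) > r, a circle of radius r > \<rho>0 with r \<ge> R e^(a+2) carries a point of
  D with |f| > R e^(a+2).\<close>

lemma tall_circle:
  obtains x0 where "\<And>x. x \<ge> x0 \<Longrightarrow>
    \<exists>\<theta>\<in>{0..2*pi}. exp (of_real x + of_real \<theta> * \<i>) \<in> D \<and> height a (of_real x + of_real \<theta> * \<i>) \<ge> 2"
proof
  define b where "b = max (\<bar>\<rho>0\<bar> + 1) (R * exp (a + 2))"
  fix x assume "x \<ge> ln b"
  moreover have "b > 0" by (simp add: b_def)
  ultimately have "exp x \<ge> b" by (metis exp_le_cancel_iff exp_ln)
  then have "exp x > \<rho>0" "exp x \<ge> R * exp (a + 2)" by (auto simp: b_def)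
  from M_large_obtain[OF this] obtain z where z: "z \<in> D" "norm z = exp x" "R * exp (a + 2) < norm (f z)" .
  have "z \<noteq> 0" using z(2) by auto
  then obtain \<theta> where \<theta>: "\<theta> \<in> {0..2*pi}" "z = exp (of_real x + of_real \<theta> * \<i>)"
    using exp_circle_point z(2) by (metis ln_exp)
  have "ln (R * exp (a + 2)) \<le> ln (norm (f z))"
    using z(3) R_pos by (subst ln_le_cancel_iff) (use z(1) norm_gt[of z] in auto)
  then have "height a (of_real x + of_real \<theta> * \<i>) \<ge> 2"
    using R_pos \<theta>(2) by (simp add: height_def ln_mult)
  then show "\<exists>\<theta>\<in>{0..2*pi}. exp (of_real x + of_real \<theta> * \<i>) \<in> D \<and> height a (of_real x + of_real \<theta> * \<i>) \<ge> 2"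
    using \<theta> z(1) by blast
qed

lemma height_shift: "height b \<zeta> = height a \<zeta> + a - b"
  by (simp add: height_def)

text \<open>If the growth were at most quadratic along a sequence, the flux would be bounded. Each circle
  leaving the set where \<open>|f|\<close> is large makes the flux grow at a definite rate, so there are
  arbitrarily large circles inside that set; there the flux is quantized, hence it is eventually
  constant, hence eventually no circle leaves the tract.\<close>

lemma superquadratic:
  obtains r0 where "\<And>r. r \<ge> r0 \<Longrightarrow> M r > C * r\<^sup>2"
proof -
  have False if neg: "\<not> (\<exists>r0. \<forall>r\<ge>r0. M r > C * r\<^sup>2)"
  proof -
    have slow: "\<exists>r\<ge>r0. M r \<le> C * r\<^sup>2" for r0
      using neg by (meson not_le)
    let ?p = "\<lambda>(x::real) (\<theta>::real). complex_of_real x + of_real \<theta> * \<i>"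
    define full where "full x \<longleftrightarrow> (\<forall>\<theta>\<in>{0..2*pi}. exp (?p x \<theta>) \<in> D \<and> height 1 (?p x \<theta>) \<ge> 2)" for x
    obtain x3 where x3: "\<And>x. x \<ge> x3 \<Longrightarrow> \<exists>\<theta>\<in>{0..2*pi}. exp (?p x \<theta>) \<in> D \<and> height 3 (?p x \<theta>) \<ge> 2"
      using tall_circle by blast
    obtain x1 where x1: "\<And>x. x \<ge> x1 \<Longrightarrow> \<exists>\<theta>\<in>{0..2*pi}. exp (?p x \<theta>) \<in> D \<and> height 1 (?p x \<theta>) \<ge> 2"
      using tall_circle by blast
    have full_ex: "\<exists>y\<ge>x. full y" for x
    proof (rule ccontr)
      assume none: "\<not> (\<exists>y\<ge>x. full y)"
      define u where "u = max x x3"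
      have e: "energy 3 y \<ge> 1 / (2 * pi)" if y: "y \<ge> u" for y
      proof -
        have "\<not> full y" using none y by (auto simp: u_def)
        then obtain \<theta> where \<theta>: "\<theta> \<in> {0..2*pi}" "exp (?p y \<theta>) \<notin> D \<or> height 1 (?p y \<theta>) < 2"
          unfolding full_def by (meson not_le)
        \<comment> \<open>Height below 2 for level 1 is height below 0 for level 3. Both levels
          occur because \<open>energy_ge\<close> asks for a point where the cutoff vanishes.\<close>
        then have "exp (?p y \<theta>) \<notin> D \<or> height 3 (?p y \<theta>) \<le> 0"
          using height_shift[of 3 "?p y \<theta>" 1] by auto
        then show ?thesis using energy_ge[of 3 \<theta> _ y] \<theta>(1) x3[of y] y by (auto simp: u_def)
      qed
      have step: "flux 3 u - u / (2 * pi) \<le> flux 3 v - v / (2 * pi)" if "v \<ge> u" for v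
      proof (rule DERIV_nonneg_imp_nondecreasing[OF that], intro exI conjI)
        fix t assume t: "u \<le> t"
        show "((\<lambda>t. flux 3 t - t / (2 * pi)) has_real_derivative energy 3 t - 1 / (2 * pi)) (at t)"
          by (intro DERIV_diff flux_has_derivative DERIV_cdivide DERIV_ident) auto
        show "0 \<le> energy 3 t - 1 / (2 * pi)" using e[OF t] by simp
      qed
      define v where "v = u + 2 * pi * (4 * pi + 1 + \<bar>flux 3 u\<bar>)"
      have "v \<ge> u" by (simp add: v_def)
      have "v / (2 * pi) - u / (2 * pi) = 4 * pi + 1 + \<bar>flux 3 u\<bar>"
        by (simp add: v_def field_simps)
      then have "flux 3 v > 4 * pi" using step[OF \<open>v \<ge> u\<close>] by simp
      then show False using flux_bounded[OF slow, of 3 v] by simp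
    qed
    define A where "A = {n::int. \<exists>x. full x \<and> flux 1 x = 2 * pi * n}"
    have quant: "\<exists>n\<in>A. flux 1 x = 2 * pi * real_of_int n" if "full x" for x
    proof (rule flux_full_circle[of x 1])
      show "exp (?p x \<theta>) \<in> D \<and> 2 \<le> height 1 (?p x \<theta>)" if "\<theta> \<in> {0..2*pi}" for \<theta>
        using \<open>full x\<close> that by (simp add: full_def)
      show "\<exists>n\<in>A. flux 1 x = 2 * pi * real_of_int n" if "flux 1 x = 2 * pi * real_of_int m" for m
        using \<open>full x\<close> that unfolding A_def by blast
    qed
    have le2: "n \<le> 2" if "n \<in> A" for n
    proof -
      have "2 * pi * real_of_int n \<le> 2 * pi * 2"
      proof -
        obtain x where "flux 1 x = 2 * pi * real_of_int n" using \<open>n \<in> A\<close> unfolding A_def by blast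
        then show ?thesis using flux_bounded[OF slow, of 1 x] by simp
      qed
      then show ?thesis by simp
    qed
    obtain n where n: "n \<in> A" "\<And>m. m \<in> A \<Longrightarrow> m \<le> n"
    proof -
      obtain k where k: "k \<in> A" using full_ex[of 0] quant by blast
      \<comment> \<open>All elements of A are at most 2, so the largest is found by minimising the
        natural number 2 - m.\<close>
      have "\<exists>m. m \<in> A \<and> (\<forall>n. n \<in> A \<longrightarrow> nat (2 - m) \<le> nat (2 - n))"
        using ex_has_least_nat[of "\<lambda>m. m \<in> A" k "\<lambda>m. nat (2 - m)"] k by blast
      then obtain m where m: "m \<in> A" "\<And>n. n \<in> A \<Longrightarrow> nat (2 - m) \<le> nat (2 - n)" by blast
      then have "n \<le> m" if "n \<in> A" for n using le2[OF that] le2[OF m(1)] m(2)[OF that] by simp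
      then show ?thesis using that m(1) by blast
    qed
    obtain x where x: "full x" "flux 1 x = 2 * pi * n" using n(1) unfolding A_def by blast
    \<comment> \<open>Beyond y there is a full circle, whose flux is at most the maximal quantized
      value, attained at x. Monotonicity squeezes the flux at y between the two.\<close>
    have const: "flux 1 y = flux 1 x" if "y \<ge> x" for y
    proof -
      obtain y' where y': "y' \<ge> y" "full y'" using full_ex by blast
      obtain m where m: "m \<in> A" "flux 1 y' = 2 * pi * real_of_int m" using quant[OF y'(2)] by blast
      have "flux 1 y \<le> flux 1 y'" "flux 1 x \<le> flux 1 y"
        using flux_mono[of 1] y'(1) that by auto
      moreover have "flux 1 y' \<le> flux 1 x" using n(2)[OF m(1)] m(2) x(2) by simp
      ultimately show ?thesis by simp
    qed
    \<comment> \<open>On the circle through this point the energy is positive by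
      \<open>energy_ge\<close>, although it is the derivative of a flux that is constant
      there.\<close>
    obtain z where z: "z \<notin> D" "norm z > exp (max x x1)"
      using unbounded_compl unfolding bounded_iff by (meson ComplD not_le)
    define y where "y = ln (norm z)"
    have "z \<noteq> 0" using z(2) exp_gt_zero by (metis less_asym norm_zero)
    then obtain \<theta> where \<theta>: "\<theta> \<in> {0..2*pi}" "z = exp (?p y \<theta>)"
      using exp_circle_point y_def by metis
    have "norm z > 0" using \<open>z \<noteq> 0\<close> by simp
    then have y: "y > x" "y \<ge> x1" using z(2) exp_ln[of "norm z"] unfolding y_def
      by (metis exp_less_cancel_iff max_less_iff_conj less_imp_le)+
    have "energy 1 y \<ge> 1 / (2 * pi)"
      using energy_ge[of 1 \<theta> _ y] \<theta> z(1) x1[OF y(2)] by auto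
    moreover have "(flux 1 has_real_derivative 0) (at y)"
    proof (rule has_field_derivative_transform_within_open[OF DERIV_const[of "flux 1 x"], of "{x<..}"])
      show "flux 1 x = flux 1 t" if "t \<in> {x<..}" for t
        using const[of t] that by simp
    qed (use y(1) in auto)
    then have "energy 1 y = 0" using flux_has_derivative[of 1 y] DERIV_unique by auto
    ultimately show False using pi_gt_zero by simp
  qed
  then show ?thesis using that by blast
qed

lemma M_attained:
  assumes "r > \<rho>0"
  obtains z where "z \<in> D" "norm z = r" "norm (f z) = M r"
proof -
  let ?S = "closure D \<inter> sphere 0 r"
  have comp: "compact ?S" by (intro closed_Int_compact) auto
  have sub: "D \<inter> sphere 0 r \<subseteq> ?S" using closure_subset by blast
  then have ne: "?S \<noteq> {}" using growing assms by blast
  have "continuous_on ?S (\<lambda>z. norm (f z))"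
    by (intro continuous_intros continuous_on_subset[OF cont_closure]) auto
  from continuous_attains_sup[OF comp ne this]
  obtain z where z: "z \<in> ?S" "\<forall>y\<in>?S. norm (f y) \<le> norm (f z)" ..
  have ge: "M r \<le> norm (f z)"
    unfolding MD_def using growing assms z(2) sub by (intro cSUP_least) auto
  have "z \<in> D"
  proof (rule ccontr)
    assume "z \<notin> D"
    then have "norm (f z) = R" using norm_closure_diff z(1) by blast
    then show False using ge M_greater[OF assms] assms R_less by linarith
  qed
  then show ?thesis using that[of z] norm_le_M_sphere[of z r] z(1) ge by simp
qed

section \<open>Covering by images of annuli\<close>

text \<open>Maximum principle for h(f z)/z^k on the part of the annulus that f maps into G. By
  \<open>clopen\<close>, f z stays in G on the closure of this part, so its frontier points lie
  outside D or on one of the two circles.\<close>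

lemma annulus_max:
  assumes G: "open G" "h holomorphic_on G" and r0: "0 < r0"
    and clopen: "\<And>z. z \<in> closure D \<Longrightarrow> r0 \<le> norm z \<Longrightarrow> norm z \<le> s \<Longrightarrow> f z \<in> closure G \<Longrightarrow> f z \<in> G"
    and bound: "\<And>z. z \<in> closure D \<Longrightarrow> f z \<in> G \<Longrightarrow> z \<notin> D \<and> r0 \<le> norm z \<or> norm z = r0 \<or> norm z = s \<Longrightarrow>
      norm (h (f z)) \<le> B * norm z ^ k"
    and z: "z \<in> D" "r0 < norm z" "norm z < s" "f z \<in> G"
  shows "norm (h (f z)) \<le> B * norm z ^ k"
proof -
  define A where "A = D \<inter> (ball 0 s - cball 0 r0)"
  define U where "U = {z \<in> A. f z \<in> G}"
  have "open A" unfolding A_def using open_D by (intro open_Int open_Diff) auto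
  moreover have "continuous_on A f"
    using holomorphic_on_imp_continuous_on[OF holomorphic] by (rule continuous_on_subset) (auto simp: A_def)
  ultimately have opU: "open U"
    unfolding U_def using continuous_open_preimage[of A f G] G(1) by (simp add: vimage_def Int_def)
  have cl1: "closure U \<subseteq> closure D \<inter> (cball 0 s - ball 0 r0)"
    using closure_subset by (intro closure_minimal) (auto simp: U_def A_def)
  have cl2: "f y \<in> G" if y: "y \<in> closure U" for y
  proof (rule clopen)
    have "continuous_on (closure U) f"
      using cl1 by (intro continuous_on_subset[OF cont_closure]) auto
    then have "f ` closure U \<subseteq> closure (f ` U)"
      by (rule continuous_image_closure_subset) simp
    also have "\<dots> \<subseteq> closure G" by (intro closure_mono) (auto simp: U_def)
    finally show "f y \<in> closure G" using y by blast
  qed (use cl1 y in auto)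
  have "norm (h (f z) / z ^ k) \<le> B"
  proof (rule maximum_modulus_frontier[of "\<lambda>z. h (f z) / z ^ k" U])
    have "(\<lambda>z. h (f z)) holomorphic_on U"
      using holomorphic_on_compose_gen[OF holomorphic_on_subset[OF holomorphic, of U] G(2)]
      by (auto simp: U_def A_def o_def)
    then show "(\<lambda>z. h (f z) / z ^ k) holomorphic_on interior U"
      unfolding interior_open[OF opU] using r0 by (intro holomorphic_intros) (auto simp: U_def A_def)
    show "continuous_on (closure U) (\<lambda>z. h (f z) / z ^ k)"
    proof (intro continuous_intros)
      show "continuous_on (closure U) (\<lambda>z. h (f z))"
        using cl1 cl2
        by (intro continuous_on_compose2[OF holomorphic_on_imp_continuous_on[OF G(2)]]
              continuous_on_subset[OF cont_closure]) auto
    qed (use cl1 r0 in fastforce)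
    show "bounded U" by (rule bounded_subset[of "ball 0 s"]) (auto simp: U_def A_def)
    show "z \<in> U" using z by (simp add: U_def A_def)
    fix y assume "y \<in> frontier U"
    then have y: "y \<in> closure U" "y \<notin> U" using opU by (auto simp: frontier_def interior_open)
    then have y2: "y \<in> closure D" "r0 \<le> norm y" "norm y \<le> s" "f y \<in> G" using cl1 cl2 by auto
    then have "y \<notin> D \<and> r0 \<le> norm y \<or> norm y = r0 \<or> norm y = s"
      using y(2) by (auto simp: U_def A_def)
    then have "norm (h (f y)) \<le> B * norm y ^ k" using bound y2 by blast
    moreover have "norm y > 0" using y2(2) r0 by linarith
    ultimately show "norm (h (f y) / y ^ k) \<le> B"
      by (simp add: norm_divide norm_power field_simps)
  qed
  moreover have "norm z > 0" using z(2) r0 by linarith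
  ultimately show ?thesis by (simp add: norm_divide norm_power field_simps)
qed

text \<open>Comparison of |f|/|z|^2 on the circles of radii r0, r and 40 r, with 1600 = 40^2:
  superquadratic growth makes M(r)/r^2 exceed the inner quotient, so by the maximum principle it
  cannot exceed the outer one as well.\<close>

lemma M_dilation:
  obtains r1 where "\<And>r. r \<ge> r1 \<Longrightarrow> 1600 * M r \<le> M (40 * r)"
proof -
  define r0 where "r0 = \<rho>0 + 1"
  have r0: "r0 > \<rho>0" "r0 > 0" using R_pos R_less by (auto simp: r0_def)
  obtain r1 where r1: "\<And>r. r \<ge> r1 \<Longrightarrow> M r > M r0 / r0\<^sup>2 * r\<^sup>2"
    using superquadratic[of "M r0 / r0\<^sup>2"] by blast
  have "1600 * M r \<le> M (40 * r)" if r: "r \<ge> max r1 (r0 + 1)" for r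
  proof (rule ccontr)
    assume neg: "\<not> 1600 * M r \<le> M (40 * r)"
    have r': "r > r0" "r > \<rho>0" "r > 0" "r \<ge> r1" using r r0 by auto
    define B where "B = max (M (40 * r) / (40 * r)\<^sup>2) (M r0 / r0\<^sup>2)"
    have "M (40 * r) / (40 * r)\<^sup>2 * r\<^sup>2 = M (40 * r) / 1600"
      using r' by (simp add: power2_eq_square)
    then have "B * r\<^sup>2 < M r" using neg r1[OF r'(4)] unfolding B_def max_def by (simp split: if_split)
    then obtain z where z: "z \<in> D" "norm z = r" "B * r\<^sup>2 < norm (f z)"
      using less_M_obtain[OF r'(2)] by blast
    have *: "M r0 / r0\<^sup>2 \<le> B" "M (40 * r) / (40 * r)\<^sup>2 \<le> B" by (auto simp: B_def)
    have MR: "M r0 > R" using M_greater[OF r0(1)] r0(1) R_less by simp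
    then have "0 \<le> M r0 / r0\<^sup>2" using R_pos by simp
    then have B0: "0 \<le> B" using *(1) by linarith
    have "norm (f z) \<le> B * norm z ^ 2"
    proof (rule annulus_max[of UNIV "\<lambda>w. w" r0 "40 * r" B 2 z])
      fix y assume y: "y \<in> closure D" "y \<notin> D \<and> r0 \<le> norm y \<or> norm y = r0 \<or> norm y = 40 * r"
      have base: "norm (f y) \<le> B * norm y ^ 2" if "norm (f y) \<le> M r0" "r0 \<le> norm y"
      proof -
        have "norm (f y) \<le> M r0 / r0\<^sup>2 * r0\<^sup>2" using that(1) r0(2) by simp
        also have "\<dots> \<le> B * norm y ^ 2"
          using *(1) that(2) r0(2) B0 by (intro mult_mono power_mono) auto
        finally show ?thesis .
      qed
      consider "y \<notin> D" "r0 \<le> norm y" | "y \<in> D" "norm y = r0" | "y \<in> D" "norm y = 40 * r"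
        using y r' by fastforce
      then show "norm (f y) \<le> B * norm y ^ 2"
      proof cases
        case 1
        then show ?thesis using base norm_closure_diff[OF y(1)] MR by simp
      next
        case 2
        then show ?thesis using base norm_le_M_sphere[of y r0] by simp
      next
        case 3
        then have "norm (f y) \<le> M (40 * r) / (40 * r)\<^sup>2 * (40 * r)\<^sup>2"
          using norm_le_M_sphere[of y "40 * r"] r' by simp
        also have "\<dots> \<le> B * (40 * r)\<^sup>2" by (intro mult_right_mono *) auto
        finally show ?thesis using 3 by simp
      qed
    qed (use z r' r0 in auto)
    then show False using z by simp
  qed
  then show ?thesis using that by blast
qed

text \<open>A Bohr-type covering property: if \<^term>\<open>f\<close> omitted \<^term>\<open>X\<close>, the composition with
  the inverse Koebe function would be bounded, tiny on a fixed circle, and of definite size on an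
  intermediate circle, contradicting the maximum principle.\<close>

lemma covering:
  obtains r1 where "\<And>r X. r \<ge> r1 \<Longrightarrow> closed X \<Longrightarrow> connected X \<Longrightarrow> \<not> bounded X \<Longrightarrow>
      X \<inter> ball 0 (M r) = {} \<Longrightarrow> X \<inter> cball 0 (1600 * M r) \<noteq> {} \<Longrightarrow> \<exists>z\<in>D. norm z < 1600 * r \<and> f z \<in> X"
proof -
  define r0 where "r0 = \<rho>0 + 1"
  have r0: "r0 > \<rho>0" "r0 > 0" using R_pos R_less by (auto simp: r0_def)
  \<comment> \<open>1750 is 7 times 250: the bound 7 |w|/|p| for the inverse Koebe function, with
    |w| \<le> M(r0) and |p| \<ge> C r, becomes r0/(250 r).\<close>
  define C where "C = 1750 * M r0 / r0"
  have MR: "M r0 > R" using M_greater[OF r0(1)] r0(1) R_less by simp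
  have C: "C > 0" using MR R_pos r0 by (simp add: C_def)
  obtain r1 where r1: "\<And>r. r \<ge> r1 \<Longrightarrow> M r > C * r\<^sup>2"
    using superquadratic[of C] by blast
  obtain r2 where r2: "\<And>r. r \<ge> r2 \<Longrightarrow> 1600 * M r \<le> M (40 * r)"
    using M_dilation by blast
  have "\<exists>z\<in>D. norm z < 1600 * r \<and> f z \<in> X"
    if r: "r \<ge> Max {r1, r2, r0 + 1, 1}" and X: "closed X" "connected X" "\<not> bounded X"
      "X \<inter> ball 0 (M r) = {}" "X \<inter> cball 0 (1600 * M r) \<noteq> {}" for r X
  proof (rule ccontr)
    assume omit: "\<not> (\<exists>z\<in>D. norm z < 1600 * r \<and> f z \<in> X)"
    have r': "r \<ge> r1" "r \<ge> r2" "r > r0" "r \<ge> 1" "r > \<rho>0" using r r0 by auto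
    have "C * r \<le> C * r\<^sup>2" using C r'(4) by (simp add: power2_eq_square)
    then have Mr: "M r > C * r" using r1[OF r'(1)] by linarith
    obtain p where p: "p \<in> X" "\<And>w. w \<in> X \<Longrightarrow> norm p \<le> norm w"
    proof -
      obtain x where x: "x \<in> X" using X(5) by blast
      show ?thesis using distance_attains_inf[OF X(1), of 0] x that by (auto simp: dist_norm)
    qed
    have pM: "M r \<le> norm p" using p(1) X(4) by force
    have "norm p \<le> 1600 * M r" using X(5) p(2) by force
    then have ps: "norm p \<le> M (40 * r)" using r2[OF r'(2)] by linarith
    have Mr0: "M r \<ge> M r0" by (rule M_mono) (use r' r0 in auto)
    have p_pos: "norm p > 0" using pM Mr0 MR R_pos by linarith
    \<comment> \<open>A maximum point on the intermediate circle: M(40 r) \<ge> 1600 M(r) \<ge> |p|,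
      which will give |K(f \<zeta>)| \<ge> 1/6.\<close>
    obtain \<zeta> where \<zeta>: "\<zeta> \<in> D" "norm \<zeta> = 40 * r" "norm (f \<zeta>) = M (40 * r)"
      using M_attained[of "40 * r"] r' r0 by force
    have f\<zeta>: "f \<zeta> \<in> - X" using omit \<zeta> r' by auto
    define G where "G = connected_component_set (- X) (f \<zeta>)"
    have G: "G \<in> components (- X)" using f\<zeta> by (auto simp: G_def components_def)
    have \<zeta>G: "f \<zeta> \<in> G" using f\<zeta> by (simp add: G_def connected_component_refl)
    have opG: "open G" using X(1) G open_components by blast
    have clG: "w \<in> G" if "w \<in> closure G" "w \<notin> X" for w
    proof -
      obtain T where T: "closed T" "G = - X \<inter> T"
        using closedin_component[OF G] by (auto simp: closedin_closed)
      then have "closure G \<subseteq> T" by (intro closure_minimal) auto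
      then show ?thesis using that T by blast
    qed
    obtain K where K: "K holomorphic_on G"
      "\<And>w. w \<in> G \<Longrightarrow> norm (K w) \<le> 6"
      "\<And>w. w \<in> G \<Longrightarrow> norm (K w) \<le> 7 * norm w / norm p"
      "\<And>w. w \<in> G \<Longrightarrow> norm p \<le> norm w \<Longrightarrow> 1 / 6 \<le> norm (K w)"
      using koebe_inverse_exists[OF X(1-3) p _ G] p_pos by auto
    \<comment> \<open>The divisor 250 lies between 240 and 1599/6: on |z| = 1599 r the right side
      exceeds the bound 6 for K, while at |\<zeta>| = 40 r it is 4/25 < 1/6. As 1599 r < 1600 r, f
      omits X at all points of D up to the outer circle.\<close>
    have "norm (K (f \<zeta>)) \<le> 1 / (250 * r) * norm \<zeta> ^ 1"
    proof (rule annulus_max[of G K r0 "1599 * r"])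
      fix z assume z: "z \<in> closure D" "r0 \<le> norm z" "norm z \<le> 1599 * r" "f z \<in> closure G"
      have "f z \<notin> X"
      proof (cases "z \<in> D")
        case False
        then show ?thesis using norm_closure_diff[OF z(1)] p(2)[of "f z"] pM Mr0 MR by auto
      qed (use omit z r' in auto)
      then show "f z \<in> G" using clG z(4) by blast
    next
      fix z assume z: "z \<in> closure D" "f z \<in> G" "z \<notin> D \<and> r0 \<le> norm z \<or> norm z = r0 \<or> norm z = 1599 * r"
      have base: "norm (K (f z)) \<le> 1 / (250 * r) * norm z ^ 1" if "norm (f z) \<le> M r0" "r0 \<le> norm z"
      proof -
        have "norm (K (f z)) \<le> 7 * norm (f z) / norm p" using K(3) z(2) by blast
        also have "\<dots> \<le> 7 * M r0 / (C * r)"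
          using that(1) pM Mr C r' MR R_pos by (intro frac_le) auto
        also have "\<dots> = r0 / (250 * r)"
          using MR R_pos r0 r' by (simp add: C_def field_simps)
        also have "\<dots> \<le> norm z / (250 * r)"
          using that(2) r' by (intro divide_right_mono) auto
        finally show ?thesis by simp
      qed
      consider "z \<notin> D" "r0 \<le> norm z" | "z \<in> D" "norm z = r0" | "norm z = 1599 * r"
        using z by blast
      then show "norm (K (f z)) \<le> 1 / (250 * r) * norm z ^ 1"
      proof cases
        case 1
        then show ?thesis using base norm_closure_diff[OF z(1)] MR by simp
      next
        case 2
        then show ?thesis using base norm_le_M_sphere[of z r0] by simp
      next
        case 3
        then have "1 / (250 * r) * norm z ^ 1 = 1599 / 250" using r' by simp
        then show ?thesis using K(2)[OF z(2)] by simp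
      qed
    qed (use opG K(1) r0 r' \<zeta> \<zeta>G in auto)
    also have "\<dots> = 4 / 25" using \<zeta>(2) r' by simp
    finally show False using K(4)[OF \<zeta>G] ps \<zeta>(3) by simp
  qed
  then show ?thesis using that by blast
qed

section \<open>Pulling back unbounded domains\<close>

lemma open_image:
  assumes "open U" "U \<subseteq> D"
  shows "open (f ` U)"
proof (rule open_mapping_thm[OF holomorphic open_D _ assms])
  show "connected D" using tract by (simp add: direct_tract_def)
  show "\<not> f constant_on D"
  proof
    assume "f constant_on D"
    then obtain c where c: "\<And>z. z \<in> D \<Longrightarrow> f z = c" unfolding constant_on_def by blast
    have "max (\<rho>0 + 1) (norm c) > \<rho>0" "max (\<rho>0 + 1) (norm c) \<ge> norm c" by auto
    from M_large_obtain[OF this] obtain z where "z \<in> D" "norm c < norm (f z)" by metis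
    then show False using c by simp
  qed
qed

text \<open>If the component Y of the preimage were bounded, f(Y) would be closed in X: a limit
  point of Y with value in X has |f| > R, so it lies in D and then in Y. By the open mapping theorem
  f(Y) is also open, so it would be all of X, which would then be bounded.\<close>

lemma unbounded_preimage_component:
  assumes X: "open X" "connected X" "\<not> bounded X" "\<And>w. w \<in> X \<Longrightarrow> norm w > R"
    and z: "z \<in> D" "f z \<in> X"
  obtains Y where "open Y" "connected Y" "\<not> bounded Y" "Y \<subseteq> D" "f ` Y \<subseteq> X" "z \<in> Y"
proof -
  define S where "S = {z \<in> D. f z \<in> X}"
  define Y where "Y = connected_component_set S z"
  have opS: "open S"
    unfolding S_def using continuous_open_preimage[OF holomorphic_on_imp_continuous_on[OF holomorphic] open_D X(1)]
    by (simp add: vimage_def Int_def)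
  have YC: "Y \<in> components S" and zY: "z \<in> Y" using z by (auto simp: Y_def S_def components_def)
  have YS: "Y \<subseteq> S" by (simp add: Y_def connected_component_subset)
  have opY: "open Y" using opS YC open_components by blast
  have "\<not> bounded Y"
  proof
    assume "bounded Y"
    then have comp: "compact (closure Y)" by simp
    have "closure Y \<subseteq> closure D" using YS by (intro closure_mono) (auto simp: S_def)
    then have compf: "compact (f ` closure Y)"
      using comp by (intro compact_continuous_image continuous_on_subset[OF cont_closure])
    have "X \<inter> f ` closure Y \<subseteq> f ` Y"
    proof
      fix w assume "w \<in> X \<inter> f ` closure Y"
      then obtain y where y: "y \<in> closure Y" "w = f y" "f y \<in> X" by auto
      have "y \<in> D"
        using norm_closure_diff[of y] X(4)[OF y(3)] y(1) \<open>closure Y \<subseteq> closure D\<close> by force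
      then have "y \<in> S" using y by (simp add: S_def)
      obtain T where T: "closed T" "Y = S \<inter> T"
        using closedin_component[OF YC] by (auto simp: closedin_closed)
      then have "closure Y \<subseteq> T" by (intro closure_minimal) auto
      then show "w \<in> f ` Y" using y \<open>y \<in> S\<close> T by blast
    qed
    moreover have fYX: "f ` Y \<subseteq> X" using YS by (auto simp: S_def)
    ultimately have "f ` Y = X \<inter> f ` closure Y" using closure_subset by blast
    then have "closedin (top_of_set X) (f ` Y)"
      using compact_imp_closed[OF compf] by (metis closedin_closed_Int)
    moreover have "openin (top_of_set X) (f ` Y)"
      using open_image[OF opY] YS fYX by (intro open_subset) (auto simp: S_def)
    ultimately have "f ` Y = X"
      using X(2) zY unfolding connected_clopen by blast
    then have "bounded X" using compf closure_subset
      by (metis bounded_subset compact_imp_bounded image_mono)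
    then show False using X(3) by simp
  qed
  then show ?thesis
    using that[OF opY _ _ _ _ zY] YS by (auto simp: Y_def S_def)
qed

text \<open>Induction on N: the domain obtained for M(r) is pulled back once under f, and
  \<open>covering\<close> makes the new domain meet the disc of radius 1600 r. That this disc is
  independent of N is what allows a compactness argument.\<close>

lemma orbit_domains:
  obtains r1 where "r1 > \<rho>0" "\<And>r N. r \<ge> r1 \<Longrightarrow> \<exists>X. open X \<and> connected X \<and> \<not> bounded X \<and>
    X \<inter> cball 0 (1600 * r) \<noteq> {} \<and> (\<forall>z\<in>X. \<forall>k\<le>N. (f ^^ k) z \<in> D \<and> norm ((f ^^ k) z) > (M ^^ k) r)"
proof -
  obtain r1 where r1: "\<And>r X. r \<ge> r1 \<Longrightarrow> closed X \<Longrightarrow> connected X \<Longrightarrow> \<not> bounded X \<Longrightarrow>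
      X \<inter> ball 0 (M r) = {} \<Longrightarrow> X \<inter> cball 0 (1600 * M r) \<noteq> {} \<Longrightarrow> \<exists>z\<in>D. norm z < 1600 * r \<and> f z \<in> X"
    using covering by blast
  define r2 where "r2 = max r1 (\<rho>0 + 1)"
  have step: "\<exists>X. open X \<and> connected X \<and> \<not> bounded X \<and> X \<inter> cball 0 (1600 * r) \<noteq> {}
      \<and> f ` X \<subseteq> X' \<and> (\<forall>z\<in>X. z \<in> D \<and> norm z > r)"
    if r: "r \<ge> r2" and X': "open X'" "connected X'" "\<not> bounded X'" "\<forall>w\<in>X'. norm w > M r"
      "X' \<inter> cball 0 (1600 * M r) \<noteq> {}" for r X'
  proof -
    have r': "r \<ge> r1" "r > \<rho>0" using r by (auto simp: r2_def)
    have MR: "M r > R" using M_greater[OF r'(2)] r'(2) R_less by simp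
    have "closure X' \<subseteq> - ball 0 (M r)"
      using X'(4) by (intro closure_minimal) (force simp: closed_Compl)+
    then have "closure X' \<inter> ball 0 (M r) = {}" by blast
    moreover have "closure X' \<inter> cball 0 (1600 * M r) \<noteq> {}"
      using X'(5) closure_subset by blast
    moreover have "\<not> bounded (closure X')"
      using X'(3) closure_subset bounded_subset by blast
    ultimately obtain y where "y \<in> D" "norm y < 1600 * r" "f y \<in> closure X'"
      using r1[OF r'(1) closed_closure connected_imp_connected_closure[OF X'(2)]] by blast
    \<comment> \<open>\<open>covering\<close> only reaches the closure of X'; openness of the image
      of f moves the point into X' itself.\<close>
    then have "f y \<in> f ` (D \<inter> ball 0 (1600 * r)) \<inter> closure X'" by simp
    then have "f ` (D \<inter> ball 0 (1600 * r)) \<inter> closure X' \<noteq> {}" by blast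
    moreover have "open (f ` (D \<inter> ball 0 (1600 * r)))"
      using open_D by (intro open_image) auto
    ultimately have "f ` (D \<inter> ball 0 (1600 * r)) \<inter> X' \<noteq> {}"
      using open_Int_closure_eq_empty by blast
    then obtain z where z: "z \<in> D" "norm z < 1600 * r" "f z \<in> X'" by auto
    obtain X where X: "open X" "connected X" "\<not> bounded X" "X \<subseteq> D" "f ` X \<subseteq> X'" "z \<in> X"
      using unbounded_preimage_component[OF X'(1-3) _ z(1,3)] X'(4) MR by (metis less_trans)
    \<comment> \<open>On X the values of f exceed M(r) in modulus, which cannot happen in D at
      distance at most r from the origin.\<close>
    have "norm y > r" if "y \<in> X" for y
      using norm_le_M[OF r'(2), of y] X'(4) X(4,5) that by force
    then show ?thesis using X z by (intro exI[of _ X]) auto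
  qed
  have "\<exists>X. open X \<and> connected X \<and> \<not> bounded X \<and>
    X \<inter> cball 0 (1600 * r) \<noteq> {} \<and> (\<forall>z\<in>X. \<forall>k\<le>N. (f ^^ k) z \<in> D \<and> norm ((f ^^ k) z) > (M ^^ k) r)"
    if "r \<ge> r2" for r N
    using that
  proof (induction N arbitrary: r)
    case 0
    have r': "r > \<rho>0" using 0 by (auto simp: r2_def)
    have pos: "M r > 0" using M_greater[OF r'] r' R_less R_pos by simp
    define E :: "complex set" where "E = - cball 0 (M r)"
    have "of_real (2 * M r) \<in> E \<inter> cball 0 (1600 * M r)"
      using pos by (simp add: E_def)
    then have "E \<inter> cball 0 (1600 * M r) \<noteq> {}" by blast
    moreover have "open E" by (simp add: E_def open_Compl)
    moreover have "connected E"
      unfolding E_def by (rule connected_complement_bounded_convex) auto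
    moreover have "\<not> bounded E"
      unfolding E_def by (rule cobounded_imp_unbounded) simp
    moreover have "\<forall>w\<in>E. norm w > M r" by (simp add: E_def)
    ultimately obtain X where "open X" "connected X" "\<not> bounded X" "X \<inter> cball 0 (1600 * r) \<noteq> {}"
      "\<forall>z\<in>X. z \<in> D \<and> norm z > r"
      using step[OF 0, of E] by blast
    then show ?case by (intro exI[of _ X]) auto
  next
    case (Suc N)
    have r': "r > \<rho>0" using Suc.prems by (auto simp: r2_def)
    then have "M r \<ge> r2" using M_greater[OF r'] Suc.prems by simp
    from Suc.IH[OF this] obtain X' where X': "open X'" "connected X'" "\<not> bounded X'"
      "X' \<inter> cball 0 (1600 * M r) \<noteq> {}"
      "\<forall>z\<in>X'. \<forall>k\<le>N. (f ^^ k) z \<in> D \<and> norm ((f ^^ k) z) > (M ^^ k) (M r)"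
      by (elim exE conjE)
    have "\<forall>w\<in>X'. norm w > M r"
    proof
      fix w assume "w \<in> X'"
      from bspec[OF X'(5) this] have "(M ^^ 0) (M r) < norm ((f ^^ 0) w)" by blast
      then show "norm w > M r" by simp
    qed
    from step[OF Suc.prems X'(1-3) this X'(4)] obtain X where X: "open X" "connected X" "\<not> bounded X" "X \<inter> cball 0 (1600 * r) \<noteq> {}"
      "f ` X \<subseteq> X'" "\<forall>z\<in>X. z \<in> D \<and> norm z > r"
      by (elim exE conjE)
    have "(f ^^ k) z \<in> D \<and> norm ((f ^^ k) z) > (M ^^ k) r" if "z \<in> X" "k \<le> Suc N" for z k
    proof (cases k)
      case 0
      then show ?thesis using X(6) that by simp
    next
      case (Suc j)
      then have "(f ^^ j) (f z) \<in> D \<and> norm ((f ^^ j) (f z)) > (M ^^ j) (M r)"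
        using X'(5) X(5) that by auto
      then show ?thesis using Suc by (simp add: funpow_swap1)
    qed
    then show ?case using X by (intro exI[of _ X]) auto
  qed
  moreover have "r2 > \<rho>0" by (simp add: r2_def)
  ultimately show ?thesis using that by blast
qed

section \<open>A limit of starting points\<close>

lemma funpow_M_greater:
  assumes "r > \<rho>0" shows "(M ^^ k) r > \<rho>0"
proof (induction k)
  case (Suc k)
  then show ?case using M_greater[OF Suc] by simp
qed (use assms in simp)

lemma funpow_M_mono:
  assumes "\<rho>0 < r" "r \<le> s" shows "(M ^^ k) r \<le> (M ^^ k) s"
proof (induction k)
  case (Suc k)
  then show ?case using M_mono[OF funpow_M_greater[OF assms(1)]] by simp
qed (use assms in simp)

text \<open>Starting points for longer and longer finite orbits accumulate at some l. Continuity of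
  f on the closure of D passes the weak inequalities to the orbit of l. An iterate on the boundary
  of D would be followed by one of modulus R, below the required bound, which exceeds
  \<rho>0.\<close>

lemma A_set_nonempty:
  assumes "\<rho> > \<rho>0"
  shows "A_set f D \<rho> \<noteq> {}"
proof -
  obtain r1 where r1: "r1 > \<rho>0" "\<And>r N. r \<ge> r1 \<Longrightarrow> \<exists>X. open X \<and> connected X \<and> \<not> bounded X \<and>
    X \<inter> cball 0 (1600 * r) \<noteq> {} \<and> (\<forall>z\<in>X. \<forall>k\<le>N. (f ^^ k) z \<in> D \<and> norm ((f ^^ k) z) > (M ^^ k) r)"
    using orbit_domains by blast
  \<comment> \<open>The domains are available only from r1 on; a larger starting radius strengthens
    all the bounds, by \<open>funpow_M_mono\<close>.\<close>
  define r where "r = max \<rho> r1"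
  have r: "r \<ge> r1" "r \<ge> \<rho>" "r > \<rho>0" using r1(1) by (auto simp: r_def)
  have "\<exists>z\<in>cball 0 (1600 * r). \<forall>k\<le>N. (f ^^ k) z \<in> D \<and> norm ((f ^^ k) z) > (M ^^ k) r" for N
    using r1(2)[OF r(1), of N] by blast
  then obtain z where z: "\<And>N. z N \<in> cball 0 (1600 * r)"
    "\<And>N k. k \<le> N \<Longrightarrow> (f ^^ k) (z N) \<in> D \<and> norm ((f ^^ k) (z N)) > (M ^^ k) r"
    by metis
  obtain l \<sigma> where \<sigma>: "strict_mono (\<sigma> :: nat \<Rightarrow> nat)" "(z \<circ> \<sigma>) \<longlonglongrightarrow> l"
    using compact_cball[of "0::complex" "1600 * r"] z(1) unfolding compact_def by metis
  have ev: "\<forall>\<^sub>F n in sequentially. (f ^^ k) (z (\<sigma> n)) \<in> D \<and> (M ^^ k) r \<le> norm ((f ^^ k) (z (\<sigma> n)))" for k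
    using z(2) le_trans[OF _ seq_suble[OF \<sigma>(1)]]
    by (intro eventually_sequentiallyI[of k]) (auto intro: less_imp_le)
  have ev_closure: "\<forall>\<^sub>F n in sequentially. (f ^^ k) (z (\<sigma> n)) \<in> closure D" for k
    using ev[of k] by eventually_elim (use closure_subset in blast)
  have in_closure: "v \<in> closure D" if "(\<lambda>n. (f ^^ k) (z (\<sigma> n))) \<longlonglongrightarrow> v" for k v
    by (rule Lim_in_closed_set[OF closed_closure ev_closure[of k] _ that]) simp
  have lim: "(\<lambda>n. (f ^^ k) (z (\<sigma> n))) \<longlonglongrightarrow> (f ^^ k) l" for k
  proof (induction k)
    case 0
    then show ?case using \<sigma>(2) by (simp add: o_def)
  next
    case (Suc k)
    have "(\<lambda>n. f ((f ^^ k) (z (\<sigma> n)))) \<longlonglongrightarrow> f ((f ^^ k) l)"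
      by (rule continuous_on_tendsto_compose[OF cont_closure Suc.IH in_closure[OF Suc.IH] ev_closure])
    then show ?case by simp
  qed
  have ge: "(M ^^ k) r \<le> norm ((f ^^ k) l)" for k
    by (rule tendsto_lowerbound[OF tendsto_norm[OF lim[of k]] eventually_mono[OF ev[of k]]]) auto
  have inD: "(f ^^ k) l \<in> D" for k
  proof (rule ccontr)
    assume "(f ^^ k) l \<notin> D"
    then have "norm ((f ^^ Suc k) l) = R"
      using norm_closure_diff in_closure[OF lim] by simp
    then show False using ge[of "Suc k"] funpow_M_greater[OF r(3), of "Suc k"] R_less by simp
  qed
  have "(M ^^ k) \<rho> \<le> norm ((f ^^ k) l)" for k
    using order_trans[OF funpow_M_mono[OF assms r(2)] ge] .
  moreover have "l \<in> D" using inD[of 0] by simp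
  ultimately have "l \<in> A_set f D \<rho>"
    unfolding A_set_def using inD by blast
  then show ?thesis by blast
qed

end

theorem theorem3p2:
  fixes f :: "complex \<Rightarrow> complex" and D :: "complex set" and R \<rho>0 :: real
  assumes "direct_tract f D R"
    and "\<rho>0 > R"
    and "\<forall>\<rho>>\<rho>0. D \<inter> sphere 0 \<rho> \<noteq> {} \<and> MD f D \<rho> > \<rho>"
  shows "\<forall>\<rho>>\<rho>0. A_set f D \<rho> \<noteq> {}"
  using growing_tract.A_set_nonempty[OF growing_tract.intro[OF assms]] by simp

end
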